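(* Let $f\in\mathcal{F}_{st}$, $\omega\in\mathcal{W}_{>0}$, and let $K\subset DOA(f)$ be nonempty, compact and positively invariant for $\dot x=f(x)$. Then for a function $V:K\to\mathbb{R}$ the following are equivalent: (1) $V\in C^1(K)$ and $V$ satisfies $\nabla V(x)\cdot f(x)=-\omega(x)$ for all $x\in K$ and $V(0)=0$; (2) $V(x)=\int_0^\infty \omega(\phi_f(t,x))\,dt$ for all $x\in K$ (the integral being finite). In particular, the problem in (1) has a unique solution $V\in C^1(K)$, and it is given by the integral formula in (2).
   Context: Fix $n\ge 1$. $\mathcal{F}_{st}$ is the set of $f\in C^1(\mathbb{R}^n;\mathbb{R}^n)$ with $f(0)=0$ whose Jacobian $\frac{\partial f}{\partial x}(0)$ is Hurwitz (all eigenvalues have negative real part). $\mathcal{W}_{>0}$ is the set of $\omega\in C^2(\mathbb{R}^n;\mathbb{R})$ with $\omega(0)=0$, $\nabla\omega(0)=0$ and Hessian $\nabla^2\omega(x)$ positive definite for every $x\in\mathbb{R}^n$. $\phi_f(t,x)$ denotes the flow, i.e. the solution at time $t$ of $\dot x=f(x)$ with initial value $x$ at $t=0$. The domain of attraction is $DOA(f):=\{x\in\mathbb{R}^n : \phi_f(t,x) \text{ exists for all } t\ge 0 \text{ and } \lim_{t\to\infty}\phi_f(t,x)=0\}$. A set $K$ is positively invariant if $\phi_f(t,x)\in K$ for all $t\ge0$ and $x\in K$; note that a nonempty compact positively invariant $K\subset DOA(f)$ contains $0$. $C^1(K)$ denotes the functions on $K$ that are restrictions of $C^1$ functions defined on an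 open neighborhood of $K$. The equation $\nabla V\cdot f=-\omega$ on $K$ is understood with $\nabla V$ the gradient of such an extension. Its value $\nabla V(x)\cdot f(x)$ for $x\in K$ does not depend on the extension, since it is the right derivative of $t\mapsto V(\phi_f(t,x))$ at $t=0$. *)

theory Defs
  imports "HOL-Analysis.Analysis"
begin

(* Intended for open U. *)
definition C1_on :: "'a::real_normed_vector set \<Rightarrow> ('a \<Rightarrow> 'b::real_normed_vector) \<Rightarrow> bool" where
  "C1_on U f \<longleftrightarrow>
     (\<exists>f' :: 'a \<Rightarrow> 'a \<Rightarrow>\<^sub>L 'b.
        (\<forall>x\<in>U. (f has_derivative blinfun_apply (f' x)) (at x)) \<and> continuous_on U f')"

definition gradient :: "('a::real_inner \<Rightarrow> real) \<Rightarrow> 'a \<Rightarrow> 'a" where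
  "gradient f x = (THE D. GDERIV f x :> D)"

definition C2_on :: "'a::real_inner set \<Rightarrow> ('a \<Rightarrow> real) \<Rightarrow> bool" where
  "C2_on U f \<longleftrightarrow> C1_on U f \<and> C1_on U (gradient f)"

definition hessian :: "(real^'n \<Rightarrow> real) \<Rightarrow> real^'n \<Rightarrow> real^'n^'n" where
  "hessian f x = jacobian (gradient f) (at x)"

definition positive_definite :: "real^'n^'n \<Rightarrow> bool" where
  "positive_definite A \<longleftrightarrow> transpose A = A \<and> (\<forall>v. v \<noteq> 0 \<longrightarrow> v \<bullet> (A *v v) > 0)"

(* The eigenvalues of a real matrix are its complex ones. *)
definition hurwitz :: "real^'n^'n \<Rightarrow> bool" where
  "hurwitz A \<longleftrightarrow>
     (\<forall>(l::complex) (v::complex^'n).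
        v \<noteq> 0 \<and> map_matrix complex_of_real A *v v = l *s v \<longrightarrow> Re l < 0)"

definition F_st :: "(real^'n \<Rightarrow> real^'n) set" where
  "F_st = {f. C1_on UNIV f \<and> f 0 = 0 \<and> hurwitz (jacobian f (at 0))}"

definition W_pos :: "(real^'n \<Rightarrow> real) set" where
  "W_pos = {w. C2_on UNIV w \<and> w 0 = 0 \<and> gradient w 0 = 0 \<and>
               (\<forall>x. positive_definite (hessian w x))}"

definition solves_ivp ::
  "('a::real_normed_vector \<Rightarrow> 'a) \<Rightarrow> 'a \<Rightarrow> real \<Rightarrow> (real \<Rightarrow> 'a) \<Rightarrow> bool" where
  "solves_ivp f x t y \<longleftrightarrow> y 0 = x \<and>
     (\<forall>s\<in>closed_segment 0 t.
        (y has_vector_derivative f (y s)) (at s within closed_segment 0 t))"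

definition flow_exists :: "('a::real_normed_vector \<Rightarrow> 'a) \<Rightarrow> real \<Rightarrow> 'a \<Rightarrow> bool" where
  "flow_exists f t x \<longleftrightarrow> (\<exists>y. solves_ivp f x t y)"

(* For a C1 vector field all solutions on the segment from 0 to t agree at t, so
   the description below is proper whenever flow_exists f t x holds. *)
definition flow :: "('a::real_normed_vector \<Rightarrow> 'a) \<Rightarrow> real \<Rightarrow> 'a \<Rightarrow> 'a" where
  "flow f t x = (THE z. \<exists>y. solves_ivp f x t y \<and> y t = z)"

definition DOA :: "('a::real_normed_vector \<Rightarrow> 'a) \<Rightarrow> 'a set" where
  "DOA f = {x. (\<forall>t\<ge>0. flow_exists f t x) \<and> ((\<lambda>t. flow f t x) \<longlongrightarrow> 0) at_top}"

definition positively_invariant ::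
  "('a::real_normed_vector \<Rightarrow> 'a) \<Rightarrow> 'a set \<Rightarrow> bool" where
  "positively_invariant f K \<longleftrightarrow>
     (\<forall>x\<in>K. \<forall>t\<ge>0. flow_exists f t x \<and> flow f t x \<in> K)"

(* Functions on K are represented by total functions, of which only the values on K matter;
   V is in C1(K) iff some U, W satisfy the following. *)
definition C1_extension ::
  "'a::real_normed_vector set \<Rightarrow> ('a \<Rightarrow> real) \<Rightarrow> 'a set \<Rightarrow> ('a \<Rightarrow> real) \<Rightarrow> bool" where
  "C1_extension K V U W \<longleftrightarrow> open U \<and> K \<subseteq> U \<and> C1_on U W \<and> (\<forall>x\<in>K. W x = V x)"

(* The gradient of V on K is that of a C1 extension W. If K is positively invariant, the
   value of the product with f on K does not depend on the choice of W. *)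
definition lyapunov_solution ::
  "('a::real_inner \<Rightarrow> 'a) \<Rightarrow> ('a \<Rightarrow> real) \<Rightarrow> 'a set \<Rightarrow> ('a \<Rightarrow> real) \<Rightarrow> bool" where
  "lyapunov_solution f w K V \<longleftrightarrow>
     (\<exists>U W. C1_extension K V U W \<and> (\<forall>x\<in>K. gradient W x \<bullet> f x = - w x)) \<and> V 0 = 0"

end

theory Submission
  imports Defs "HOL-Computational_Algebra.Fundamental_Theorem_Algebra"
begin

text \<open>Along a trajectory in \<open>K\<close>, a solution \<open>V\<close> of the partial differential equation has derivative \<open>- \<omega>\<close>,
so \<open>V x\<close> equals the integral of \<open>\<omega>\<close> over \<open>{0..T}\<close> plus the value of \<open>V\<close> at the time-\<open>T\<close> point.
The latter tends to \<open>V 0 = 0\<close> by attraction, which gives the integral formula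
(\<open>orbit_integral_of_lyapunov_solution\<close>) and with it uniqueness on \<open>K\<close>.

The converse needs the value function, \<open>x\<close> to the integral of \<open>\<omega>\<close> along the orbit of \<open>x\<close>, to have
a continuously differentiable extension to a neighbourhood of \<open>K\<close>; the equation itself then follows by differentiating
the semigroup identity for the integral at time 0 (\<open>gradient_of_orbit_integral\<close>). The smoothness is reduced to a
statement about one map. Fix a small \<open>h > 0\<close>, and let \<open>\<psi>\<close> be the time-\<open>h\<close> map of the flow
and \<open>G x\<close> the integral of \<open>\<omega>\<close> along the orbit of \<open>x\<close> over \<open>{0..h}\<close>. On \<open>K\<close> the value function is the orbit sum
of \<open>G ((\<psi> ^^ k) x)\<close> over \<open>k\<close>, and the latter makes sense near \<open>K\<close> whether or not orbits through
nearby points are globally defined. Three facts make this sum continuously differentiable.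

\<^item> \<open>\<psi>\<close> and \<open>G\<close> are continuously differentiable. For short times the Picard iterates and their derivatives
in the initial value converge uniformly (\<open>short_time_flow\<close>). Adjoining the equation \<open>v' = \<omega> x\<close> to
\<open>x' = f x\<close> turns \<open>G\<close> into a component of a flow (\<open>short_time_flow_and_integral\<close>).

\<^item> \<open>\<psi>\<close> contracts near 0 in a suitable inner product. For a Hurwitz matrix \<open>A\<close> and small \<open>\<eta> > 0\<close>,
the Euler step \<open>M v = v + \<eta> A v\<close> has summable orbits, and \<open>B u v\<close>, the sum of the inner products of
\<open>(M ^^ k) u\<close> and \<open>(M ^^ k) v\<close>, is a Lyapunov form (\<open>hurwitz_lyapunov_form\<close>). It is strictly decreasing along
differences of solutions near 0 (\<open>flow_contracts_near_equilibrium\<close>), so the functions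
\<open>G ((\<psi> ^^ k) x)\<close> have geometrically decaying Lipschitz constants there, and their series may be
differentiated term by term (\<open>C1_orbit_sum_near_fixed_point\<close>).

\<^item> Every orbit in \<open>K\<close> reaches the contraction region, and the orbit sum \<open>S\<close> satisfies
\<open>S x = G x + S (\<psi> x)\<close>. Smoothness therefore propagates backwards along \<open>\<psi>\<close> to a
neighbourhood of the compact set \<open>K\<close> (\<open>C1_orbit_sum_near_compact\<close>).\<close>

section \<open>Continuously differentiable maps\<close>

lemma C1_on_subset: "C1_on U f \<Longrightarrow> S \<subseteq> U \<Longrightarrow> C1_on S f"
  unfolding C1_on_def by (meson continuous_on_subset subsetD)

lemma C1_on_imp_continuous_on:
  assumes "C1_on U f" shows "continuous_on U f"
  using assms unfolding C1_on_def
  by (metis continuous_at_imp_continuous_on has_derivative_continuous)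

lemma C1_on_cong:
  assumes "open U" "C1_on U f" and eq: "\<And>x. x \<in> U \<Longrightarrow> g x = f x"
  shows "C1_on U g"
proof -
  obtain f' where f': "\<And>x. x \<in> U \<Longrightarrow> (f has_derivative blinfun_apply (f' x)) (at x)" "continuous_on U f'"
    using assms(2) unfolding C1_on_def by blast
  have "(g has_derivative blinfun_apply (f' x)) (at x)" if "x \<in> U" for x
    by (rule has_derivative_transform_within_open[OF f'(1)[OF that] assms(1) that]) (simp add: eq)
  with f'(2) show ?thesis unfolding C1_on_def by blast
qed

lemma C1_on_bounded_linear:
  assumes "bounded_linear L" shows "C1_on U L"
  unfolding C1_on_def
  by (rule exI[where x="\<lambda>_. Blinfun L"])
     (auto simp: bounded_linear_Blinfun_apply assms intro!: bounded_linear_imp_has_derivative)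

lemma C1_on_add:
  assumes "C1_on U f" "C1_on U g" shows "C1_on U (\<lambda>x. f x + g x)"
proof -
  obtain f' g' where
    "\<And>x. x \<in> U \<Longrightarrow> (f has_derivative blinfun_apply (f' x)) (at x)" "continuous_on U f'"
    "\<And>x. x \<in> U \<Longrightarrow> (g has_derivative blinfun_apply (g' x)) (at x)" "continuous_on U g'"
    using assms unfolding C1_on_def by blast
  then show ?thesis unfolding C1_on_def
    by (intro exI[where x="\<lambda>x. f' x + g' x"])
       (auto simp: plus_blinfun.rep_eq intro!: has_derivative_add continuous_intros)
qed

lemma C1_on_compose:
  assumes "C1_on U f" "C1_on S g" "f ` U \<subseteq> S" shows "C1_on U (\<lambda>x. g (f x))"
proof -
  obtain f' g' where
    f': "\<And>x. x \<in> U \<Longrightarrow> (f has_derivative blinfun_apply (f' x)) (at x)" "continuous_on U f'" and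
    g': "\<And>x. x \<in> S \<Longrightarrow> (g has_derivative blinfun_apply (g' x)) (at x)" "continuous_on S g'"
    using assms unfolding C1_on_def by blast
  have "((\<lambda>x. g (f x)) has_derivative blinfun_apply (g' (f x) o\<^sub>L f' x)) (at x)" if "x \<in> U" for x
  proof -
    have "f x \<in> S" using assms(3) that by auto
    from has_derivative_compose[OF f'(1)[OF that] g'(1)[OF this]] show ?thesis
      by (simp add: blinfun_compose.rep_eq o_def)
  qed
  moreover have "continuous_on U (\<lambda>x. g' (f x) o\<^sub>L f' x)"
    using continuous_on_compose2[OF g'(2) C1_on_imp_continuous_on[OF assms(1)] assms(3)] f'(2)
    by (intro continuous_intros)
  ultimately show ?thesis unfolding C1_on_def
    by (intro exI[where x="\<lambda>x. g' (f x) o\<^sub>L f' x"]) auto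
qed

lemma C1_on_Pair:
  assumes "C1_on U f" "C1_on U g" shows "C1_on U (\<lambda>x. (f x, g x))"
proof -
  have "bounded_linear (\<lambda>y::'b. (y, 0::'c))" "bounded_linear (\<lambda>y::'c. (0::'b, y))"
    by (intro bounded_linear_Pair bounded_linear_zero bounded_linear_ident)+
  then have "C1_on U (\<lambda>x. (f x, 0) + (0, g x))"
    by (intro C1_on_add C1_on_compose[OF assms(1) C1_on_bounded_linear[where U=UNIV]]
        C1_on_compose[OF assms(2) C1_on_bounded_linear[where U=UNIV]]) auto
  then show ?thesis by simp
qed

lemma C1_on_lipschitz_cball:
  fixes f :: "'a::euclidean_space \<Rightarrow> 'b::real_normed_vector"
  assumes "C1_on U f" "cball 0 r \<subseteq> U"
  obtains L where "L > 0" "\<And>x y. x \<in> cball 0 r \<Longrightarrow> y \<in> cball 0 r \<Longrightarrow> norm (f x - f y) \<le> L * norm (x - y)"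
proof -
  obtain f' where
    f': "\<And>x. x \<in> U \<Longrightarrow> (f has_derivative blinfun_apply (f' x)) (at x)" "continuous_on U f'"
    using assms(1) unfolding C1_on_def by blast
  have "compact (f' ` cball 0 r)"
    using continuous_on_subset[OF f'(2) assms(2)] by (intro compact_continuous_image) auto
  then obtain L where L: "L > 0" "\<forall>z\<in>f' ` cball 0 r. norm z \<le> L"
    using compact_imp_bounded bounded_pos by metis
  have "norm (f x - f y) \<le> L * norm (x - y)" if "x \<in> cball 0 r" "y \<in> cball 0 r" for x y
  proof (rule differentiable_bound[where S="cball 0 r" and f'="\<lambda>x. blinfun_apply (f' x)"])
    show "(f has_derivative blinfun_apply (f' x)) (at x within cball 0 r)" if "x \<in> cball 0 r" for x
      using f'(1) assms(2) that has_derivative_at_withinI by blast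
    show "onorm (blinfun_apply (f' x)) \<le> L" if "x \<in> cball 0 r" for x
      using L(2) that by (simp add: norm_blinfun.rep_eq)
  qed (use that in auto)
  with L(1) that show thesis by blast
qed

section \<open>Solutions of initial value problems and their flow\<close>

text \<open>Gronwall: \<open>exp (- c * s) * q s\<close> is nonincreasing.\<close>

lemma exponential_bound_of_differential_inequality:
  fixes q q' :: "real \<Rightarrow> real"
  assumes "\<And>s. s \<in> {0..T} \<Longrightarrow> (q has_real_derivative q' s) (at s within {0..T})"
    and "\<And>s. s \<in> {0..T} \<Longrightarrow> q' s \<le> c * q s" and "0 \<le> t" "t \<le> T"
  shows "q t \<le> exp (c * t) * q 0"
proof (cases "t = 0")
  case False
  define g where "g s = exp (- c * s) * q s" for s
  have der: "(g has_real_derivative exp (- c * s) * (q' s - c * q s)) (at s within {0..T})"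
    if "s \<in> {0..T}" for s
    unfolding g_def
    by (rule derivative_eq_intros assms(1)[OF that] refl)+ (simp add: algebra_simps)
  have "g t \<le> g 0"
  proof (rule DERIV_nonpos_imp_decreasing_open[where f=g and a=0 and b=t])
    show "continuous_on {0..t} g"
      using der \<open>t \<le> T\<close> by (intro continuous_on_subset[where s="{0..T}" and t="{0..t}"]
          DERIV_continuous_on) auto
    fix s assume that: "0 < s" "s < t"
    show "\<exists>y. (g has_real_derivative y) (at s) \<and> y \<le> 0"
    proof -
      have "at s within {0..T} = at s" using that \<open>t \<le> T\<close> by (intro at_within_interior) auto
      then show ?thesis using der[of s] assms(2)[of s] that \<open>t \<le> T\<close>
        by (intro exI[where x="exp (- c * s) * (q' s - c * q s)"]) (auto simp: mult_nonneg_nonpos)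
    qed
  qed (use False assms in auto)
  then have "exp (c * t) * g t \<le> exp (c * t) * g 0" by (intro mult_left_mono) auto
  then show ?thesis by (simp add: g_def flip: mult.assoc exp_add)
qed auto

text \<open>The three uses differ in \<open>B\<close> and in the sign of \<open>c\<close>. The inner product with a Lipschitz constant
gives uniqueness, and growth bounds against the constant solution; a Lyapunov form with \<open>c < 0\<close> gives contraction.\<close>

lemma quadratic_form_of_solutions:
  fixes y z :: "real \<Rightarrow> 'a::real_normed_vector" and B :: "'a \<Rightarrow> 'a \<Rightarrow> real"
  assumes "bounded_bilinear B" and sym: "\<And>u v. B u v = B v u"
    and sol: "solves_ivp f a T y" "solves_ivp f b T z"
    and diss: "\<And>s. s \<in> {0..T} \<Longrightarrow> B (y s - z s) (f (y s) - f (z s)) \<le> c * B (y s - z s) (y s - z s)"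
    and t: "0 \<le> t" "t \<le> T"
  shows "B (y t - z t) (y t - z t) \<le> exp (2 * c * t) * B (a - b) (a - b)"
proof -
  interpret bounded_bilinear B by fact
  define w where "w s = y s - z s" for s
  have seg: "closed_segment 0 T = {0..T}" using t by (simp add: closed_segment_eq_real_ivl)
  have w': "(w has_vector_derivative f (y s) - f (z s)) (at s within {0..T})" if "s \<in> {0..T}" for s
    using sol that unfolding w_def solves_ivp_def seg
    by (intro has_vector_derivative_diff) auto
  have "((\<lambda>s. B (w s) (w s)) has_real_derivative 2 * B (w s) (f (y s) - f (z s))) (at s within {0..T})"
    if "s \<in> {0..T}" for s
    using has_vector_derivative[OF w'[OF that] w'[OF that]]
    by (simp add: has_real_derivative_iff_has_vector_derivative sym[of "f (y s) - f (z s)"])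
  then have "B (w t) (w t) \<le> exp (2 * c * t) * B (w 0) (w 0)"
    by (rule exponential_bound_of_differential_inequality) (use diss t in \<open>auto simp: w_def\<close>)
  then show ?thesis using sol by (simp add: w_def solves_ivp_def)
qed

lemma solves_ivp_iff:
  "T \<ge> 0 \<Longrightarrow> solves_ivp f x T y \<longleftrightarrow>
     y 0 = x \<and> (\<forall>s\<in>{0..T}. (y has_vector_derivative f (y s)) (at s within {0..T}))"
  by (simp add: solves_ivp_def closed_segment_eq_real_ivl)

lemma solves_ivp_continuous_on:
  "T \<ge> 0 \<Longrightarrow> solves_ivp f x T y \<Longrightarrow> continuous_on {0..T} y"
  by (rule continuous_on_vector_derivative) (auto simp: solves_ivp_iff)

lemma solves_ivp_cong:
  assumes "T \<ge> 0" "solves_ivp f x T y" "\<And>s. s \<in> {0..T} \<Longrightarrow> z s = y s"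
  shows "solves_ivp f x T z"
proof -
  have "(z has_vector_derivative f (z s)) (at s within {0..T})" if "s \<in> {0..T}" for s
    using has_vector_derivative_transform[OF that assms(3), where f'="f (z s)"] assms that
    by (simp add: solves_ivp_iff)
  then show ?thesis using assms by (auto simp: solves_ivp_iff)
qed

lemma solves_ivp_shift:
  assumes sol: "solves_ivp f x T y" and st: "0 \<le> s" "0 \<le> t" "s + t \<le> T"
  shows "solves_ivp f (y s) t (\<lambda>\<tau>. y (s + \<tau>))"
proof -
  have "((\<lambda>\<tau>. y (s + \<tau>)) has_vector_derivative f (y (s + r))) (at r within {0..t})" if r: "r \<in> {0..t}" for r
  proof -
    have "(y has_vector_derivative f (y (s + r))) (at (s + r) within {0..T})"
      using sol r st solves_ivp_iff[of T f x y] by auto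
    moreover have "(+) s ` {0..t} \<subseteq> {0..T}" using st by auto
    ultimately have "(y has_vector_derivative f (y (s + r))) (at (s + r) within (+) s ` {0..t})"
      by (rule has_vector_derivative_within_subset)
    moreover have "((+) s has_vector_derivative 1) (at r within {0..t})"
      using has_vector_derivative_add[OF has_vector_derivative_const has_vector_derivative_id] by simp
    ultimately have "(y \<circ> (+) s has_vector_derivative 1 *\<^sub>R f (y (s + r))) (at r within {0..t})"
      by (intro vector_diff_chain_within)
    then show ?thesis by (simp add: o_def)
  qed
  then show ?thesis using st(2) by (simp add: solves_ivp_iff)
qed

lemma solves_ivp_restrict:
  "solves_ivp f x T y \<Longrightarrow> 0 \<le> t \<Longrightarrow> t \<le> T \<Longrightarrow> solves_ivp f x t y"
  using solves_ivp_shift[of f x T y 0 t] by (auto simp: solves_ivp_def)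

context
  fixes f :: "'a::euclidean_space \<Rightarrow> 'a"
  assumes C1: "C1_on UNIV f"
begin

lemma solves_ivp_unique:
  assumes "solves_ivp f x T y" "solves_ivp f x T z" "0 \<le> t" "t \<le> T"
  shows "y t = z t"
proof -
  have "compact (y ` {0..T} \<union> z ` {0..T})"
    using assms by (intro compact_Un compact_continuous_image solves_ivp_continuous_on) auto
  then obtain r where r: "\<forall>v \<in> y ` {0..T} \<union> z ` {0..T}. norm v \<le> r"
    using compact_imp_bounded bounded_iff by metis
  obtain L where L: "L > 0" "\<And>u v. u \<in> cball 0 r \<Longrightarrow> v \<in> cball 0 r \<Longrightarrow> norm (f u - f v) \<le> L * norm (u - v)"
    using C1_on_lipschitz_cball[OF C1 subset_UNIV] by blast
  have "(y t - z t) \<bullet> (y t - z t) \<le> exp (2 * L * t) * ((x - x) \<bullet> (x - x))"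
  proof (rule quadratic_form_of_solutions[OF bounded_bilinear_inner inner_commute assms(1,2) _ assms(3,4)])
    fix s assume "s \<in> {0..T}"
    then have "norm (f (y s) - f (z s)) \<le> L * norm (y s - z s)" using r by (intro L(2)) auto
    then have "norm (y s - z s) * norm (f (y s) - f (z s)) \<le> norm (y s - z s) * (L * norm (y s - z s))"
      by (rule mult_left_mono) auto
    then show "(y s - z s) \<bullet> (f (y s) - f (z s)) \<le> L * ((y s - z s) \<bullet> (y s - z s))"
      using norm_cauchy_schwarz[of "y s - z s" "f (y s) - f (z s)"]
      by (simp add: dot_square_norm power2_eq_square algebra_simps)
  qed
  then have "(norm (y t - z t))\<^sup>2 \<le> 0" by (simp add: dot_square_norm)
  then show ?thesis by simp
qed

text \<open>Uniqueness makes the definite description in \<open>flow\<close> proper, so the flow can be computed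
from any solution.\<close>

lemma flow_eq:
  assumes "solves_ivp f x t y" "0 \<le> t" shows "flow f t x = y t"
  unfolding flow_def
proof (rule the_equality)
  fix z assume "\<exists>y. solves_ivp f x t y \<and> y t = z"
  then show "z = y t" using solves_ivp_unique[OF _ assms(1) assms(2) order_refl] by blast
qed (use assms in blast)

lemma flow_eq_on:
  assumes "solves_ivp f x T y" "0 \<le> t" "t \<le> T" shows "flow f t x = y t"
  by (rule flow_eq[OF solves_ivp_restrict[OF assms] assms(2)])

lemma solves_ivp_flow:
  assumes "flow_exists f T x" "0 \<le> T" shows "solves_ivp f x T (\<lambda>t. flow f t x)"
proof -
  obtain y where y: "solves_ivp f x T y" using assms(1) unfolding flow_exists_def by blast
  show ?thesis by (rule solves_ivp_cong[OF assms(2) y]) (use flow_eq_on[OF y] in auto)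
qed

lemma flow_zero: "flow_exists f T x \<Longrightarrow> 0 \<le> T \<Longrightarrow> flow f 0 x = x"
  using solves_ivp_flow[of T x] by (simp add: solves_ivp_def)

lemma flow_add:
  assumes "flow_exists f (s + t) x" "0 \<le> s" "0 \<le> t"
  shows "flow f (s + t) x = flow f t (flow f s x)"
  using flow_eq[OF solves_ivp_shift[OF solves_ivp_flow[OF assms(1)]], of s t] assms by simp

end

section \<open>Differentiability of the flow in the initial value for short times\<close>

text \<open>Rescaling time by \<open>t\<close> moves the variable bound into the integrand, where it is
one more parameter.\<close>

lemma continuous_on_integral_variable_bound:
  fixes g :: "'a::topological_space \<Rightarrow> real \<Rightarrow> 'b::banach"
  assumes "continuous_on (S \<times> {0..h}) (\<lambda>(x, t). g x t)"
  shows "continuous_on (S \<times> {0..h}) (\<lambda>(x, t). integral {0..t} (g x))"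
proof -
  have scale: "integral {0..t} (g x) = t *\<^sub>R integral {0..1} (\<lambda>\<sigma>. g x (t * \<sigma>))" if "0 \<le> t" for t x
  proof (cases "t = 0")
    case False
    have "(\<lambda>x. x / t) ` {0..t} = {0..1}"
      using False that by (simp add: image_divide_atLeastAtMost)
    then show ?thesis using integral_stretch_real[OF False, of 0 t "g x"] False that by simp
  qed auto
  have "continuous_on ((S \<times> {0..h}) \<times> cbox 0 1) (\<lambda>(p, \<sigma>). g (fst p) (snd p * \<sigma>))"
    unfolding split_beta
    by (rule continuous_on_compose2[OF assms, unfolded split_beta,
          where f="\<lambda>q. (fst (fst q), snd (fst q) * snd q)", simplified])
       (auto intro!: continuous_intros mult_left_le order.trans[OF mult_left_le])
  then have "continuous_on (S \<times> {0..h}) (\<lambda>p. snd p *\<^sub>R integral (cbox 0 1) (\<lambda>\<sigma>. g (fst p) (snd p * \<sigma>)))"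
    by (intro continuous_intros integral_continuous_on_param)
  then show ?thesis
    by (rule continuous_on_eq) (auto simp: scale)
qed

primrec picard :: "('a::euclidean_space \<Rightarrow> 'a) \<Rightarrow> nat \<Rightarrow> real \<Rightarrow> 'a \<Rightarrow> 'a" where
  "picard F 0 = (\<lambda>t x. x)"
| "picard F (Suc k) = (\<lambda>t x. x + integral {0..t} (\<lambda>s. F (picard F k s x)))"

text \<open>The formal derivatives of the Picard iterates in the initial value, i.e. the Picard iterates of the
variational equation along them.\<close>

primrec picard_deriv ::
  "('a::euclidean_space \<Rightarrow> 'a) \<Rightarrow> ('a \<Rightarrow> 'a \<Rightarrow>\<^sub>L 'a) \<Rightarrow> nat \<Rightarrow> real \<Rightarrow> 'a \<Rightarrow> 'a \<Rightarrow>\<^sub>L 'a" where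
  "picard_deriv F F' 0 = (\<lambda>t x. id_blinfun)"
| "picard_deriv F F' (Suc k) =
     (\<lambda>t x. id_blinfun + integral {0..t} (\<lambda>s. F' (picard F k s x) o\<^sub>L picard_deriv F F' k s x))"

context
  fixes F :: "'a::euclidean_space \<Rightarrow> 'a" and F' :: "'a \<Rightarrow> 'a \<Rightarrow>\<^sub>L 'a" and R M L h :: real
  assumes F': "\<And>x. (F has_derivative blinfun_apply (F' x)) (at x)" "continuous_on UNIV F'"
    and M: "\<forall>x\<in>cball 0 (R + 1). norm (F x) \<le> M"
    and L: "\<forall>x\<in>cball 0 (R + 1). norm (F' x) \<le> L"
    and h: "0 \<le> h" "h * M \<le> 1" "h * L \<le> 1 / 2" and L0: "0 \<le> L"
begin

lemma continuous_on_F: "continuous_on UNIV F"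
  using F'(1) by (meson continuous_at_imp_continuous_on has_derivative_continuous)

lemma continuous_on_picard: "continuous_on (UNIV \<times> {0..h}) (\<lambda>(x, t). picard F k t x)"
proof (induction k)
  case 0
  show ?case by (auto simp: split_beta intro!: continuous_intros)
next
  case (Suc k)
  have "continuous_on (UNIV \<times> {0..h}) (\<lambda>(x, s). F (picard F k s x))"
    using continuous_on_compose2[OF continuous_on_F Suc] by (simp add: split_beta)
  from continuous_on_integral_variable_bound[OF this] show ?case
    by (auto simp: split_beta intro!: continuous_intros)
qed

lemma continuous_on_picard_deriv:
  "continuous_on (UNIV \<times> {0..h}) (\<lambda>(x, t). picard_deriv F F' k t x)"
proof (induction k)
  case 0
  show ?case by (auto simp: split_beta)
next
  case (Suc k)
  have "continuous_on (UNIV \<times> {0..h}) (\<lambda>(x, s). F' (picard F k s x))"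
    using continuous_on_compose2[OF F'(2) continuous_on_picard] by (simp add: split_beta)
  then have "continuous_on (UNIV \<times> {0..h}) (\<lambda>(x, s). F' (picard F k s x) o\<^sub>L picard_deriv F F' k s x)"
    using Suc by (auto simp: split_beta intro!: continuous_intros)
  from continuous_on_integral_variable_bound[OF this] show ?case
    by (auto simp: split_beta intro!: continuous_intros)
qed

lemma continuous_on_picard_time:
  assumes "t \<le> h"
  shows "continuous_on {0..t} (\<lambda>s. picard F k s x)"
    and "continuous_on {0..t} (\<lambda>s. F (picard F k s x))"
    and "continuous_on {0..t} (\<lambda>s. F' (picard F k s x) o\<^sub>L picard_deriv F F' k s x)"
proof -
  have pair: "continuous_on {0..t} (\<lambda>s. (x, s))" "(\<lambda>s. (x, s)) ` {0..t} \<subseteq> UNIV \<times> {0..h}"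
    using assms by (auto intro!: continuous_intros)
  show p: "continuous_on {0..t} (\<lambda>s. picard F k s x)"
    using continuous_on_compose2[OF continuous_on_picard pair] by simp
  show "continuous_on {0..t} (\<lambda>s. F (picard F k s x))"
    using continuous_on_compose2[OF continuous_on_F p] by simp
  show "continuous_on {0..t} (\<lambda>s. F' (picard F k s x) o\<^sub>L picard_deriv F F' k s x)"
    using continuous_on_compose2[OF F'(2) p] continuous_on_compose2[OF continuous_on_picard_deriv pair]
    by (intro continuous_intros) auto
qed

lemma picard_has_derivative:
  "t \<in> {0..h} \<Longrightarrow> (picard F k t has_derivative blinfun_apply (picard_deriv F F' k t x)) (at x)"
proof (induction k arbitrary: t x)
  case 0
  show ?case by simp
next
  case (Suc k)
  have "((\<lambda>x. integral (cbox 0 t) (\<lambda>s. F (picard F k s x))) has_derivative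
      blinfun_apply (integral (cbox 0 t) (\<lambda>s. F' (picard F k s x) o\<^sub>L picard_deriv F F' k s x))) (at x within UNIV)"
  proof (rule leibniz_rule)
    fix x s assume "s \<in> cbox 0 t"
    then have "s \<in> {0..h}" using Suc.prems by auto
    from has_derivative_compose[OF Suc.IH[OF this] F'(1)]
    show "((\<lambda>x. F (picard F k s x)) has_derivative
        blinfun_apply (F' (picard F k s x) o\<^sub>L picard_deriv F F' k s x)) (at x within UNIV)"
      by (simp add: blinfun_compose.rep_eq o_def)
  next
    fix x show "(\<lambda>s. F (picard F k s x)) integrable_on cbox 0 t"
      using continuous_on_picard_time(2)[of t] Suc.prems by (auto intro!: integrable_continuous_real)
  next
    have sub: "UNIV \<times> cbox 0 t \<subseteq> UNIV \<times> {0..h}" using Suc.prems by auto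
    note c = continuous_on_subset[OF continuous_on_picard sub] continuous_on_subset[OF continuous_on_picard_deriv sub]
    show "continuous_on (UNIV \<times> cbox 0 t) (\<lambda>(x, s). F' (picard F k s x) o\<^sub>L picard_deriv F F' k s x)"
      using continuous_on_compose2[OF F'(2) c(1)] c(2)
      by (auto simp: split_beta intro!: continuous_intros)
  qed auto
  then show ?case
    by (auto simp: plus_blinfun.rep_eq intro!: derivative_eq_intros)
qed

text \<open>For times up to \<open>h \<le> 1 / M\<close> the iterates move by at most 1, so they stay in the ball where the bounds on
\<open>F\<close> and \<open>F'\<close> are available.\<close>

lemma picard_near:
  assumes "x \<in> ball 0 R"
  shows "t \<in> {0..h} \<Longrightarrow> norm (picard F k t x - x) \<le> 1 \<and> picard F k t x \<in> cball 0 (R + 1)"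
proof (induction k arbitrary: t)
  case 0
  show ?case using assms by simp
next
  case (Suc k)
  have M0: "M \<ge> 0" using bspec[OF M, of x] assms by (auto intro: order_trans[OF norm_ge_zero])
  have "norm (integral {0..t} (\<lambda>s. F (picard F k s x))) \<le> M * (t - 0)"
    using Suc M by (intro integral_bound continuous_on_picard_time) auto
  also have "\<dots> \<le> h * M" using Suc.prems M0 by (auto simp: mult.commute mult_left_mono)
  also have "\<dots> \<le> 1" by fact
  finally have n: "norm (picard F (Suc k) t x - x) \<le> 1" by simp
  moreover have "norm (picard F (Suc k) t x) \<le> norm x + norm (picard F (Suc k) t x - x)"
    by (rule norm_triangle_sub)
  ultimately show ?case using assms by (simp del: picard.simps)
qed

lemma F_lipschitz:
  assumes "a \<in> cball 0 (R + 1)" "b \<in> cball 0 (R + 1)"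
  shows "norm (F a - F b) \<le> L * norm (a - b)"
  by (rule differentiable_bound[where S="cball 0 (R + 1)" and f'="\<lambda>x. blinfun_apply (F' x)"])
     (use assms F' L in \<open>auto simp: norm_blinfun.rep_eq[symmetric] intro: has_derivative_at_withinI\<close>)

lemma time_bound_le:
  assumes "norm I \<le> C * (t - 0)" "C \<ge> 0" "t \<in> {0..h}" shows "norm I \<le> h * C"
  using assms mult_left_mono[of t h C] by (auto simp: mult.commute)

lemma picard_deriv_bound:
  assumes "x \<in> ball 0 R"
  shows "t \<in> {0..h} \<Longrightarrow> norm (picard_deriv F F' k t x) \<le> 2"
proof (induction k arbitrary: t)
  case 0
  show ?case by (simp add: norm_blinfun_id_le[THEN order_trans])
next
  case (Suc k)
  have "norm (integral {0..t} (\<lambda>s. F' (picard F k s x) o\<^sub>L picard_deriv F F' k s x)) \<le> (L * 2) * (t - 0)"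
  proof (intro integral_bound continuous_on_picard_time)
    fix s assume "s \<in> {0..t}"
    then have "s \<in> {0..h}" using Suc.prems by auto
    then have "norm (F' (picard F k s x)) * norm (picard_deriv F F' k s x) \<le> L * 2"
      using bspec[OF L conjunct2[OF picard_near[OF assms]]] Suc.IH L0 by (intro mult_mono) auto
    then show "norm (F' (picard F k s x) o\<^sub>L picard_deriv F F' k s x) \<le> L * 2"
      using norm_blinfun_compose order_trans by blast
  qed (use Suc.prems in auto)
  from time_bound_le[OF this] have "norm (integral {0..t} (\<lambda>s. F' (picard F k s x) o\<^sub>L picard_deriv F F' k s x)) \<le> 1"
    using L0 Suc.prems h by (auto simp: algebra_simps)
  then show ?case using norm_triangle_mono[OF norm_blinfun_id_le] by fastforce
qed

text \<open>Each iteration contributes a factor \<open>h * L \<le> 1 / 2\<close>; the start is the distance of at most 1 of each iterate to \<open>x\<close>.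
Comparing arbitrary \<open>k, m \<ge> i\<close> avoids summing consecutive differences.\<close>

lemma picard_cauchy:
  assumes "x \<in> ball 0 R"
  shows "t \<in> {0..h} \<Longrightarrow> k \<ge> i \<Longrightarrow> m \<ge> i \<Longrightarrow> norm (picard F k t x - picard F m t x) \<le> 2 * (1 / 2) ^ i"
proof (induction i arbitrary: k m t)
  case 0
  then show ?case
    using picard_near[OF assms 0(1), of k] picard_near[OF assms 0(1), of m]
      norm_triangle_ineq4[of "picard F k t x - x" "picard F m t x - x"] by simp
next
  case (Suc i)
  then obtain k' m' where km: "k = Suc k'" "m = Suc m'" "k' \<ge> i" "m' \<ge> i"
    by (metis Suc_le_D Suc_le_mono)
  have "norm (integral {0..t} (\<lambda>s. F (picard F k' s x) - F (picard F m' s x))) \<le> (L * (2 * (1 / 2) ^ i)) * (t - 0)"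
  proof (intro integral_bound continuous_on_diff continuous_on_picard_time)
    fix s assume "s \<in> {0..t}"
    then have s: "s \<in> {0..h}" using Suc.prems by auto
    have "norm (F (picard F k' s x) - F (picard F m' s x)) \<le> L * norm (picard F k' s x - picard F m' s x)"
      using picard_near[OF assms s] by (intro F_lipschitz) auto
    also have "\<dots> \<le> L * (2 * (1 / 2) ^ i)"
      using Suc.IH[OF s km(3,4)] L0 by (rule mult_left_mono)
    finally show "norm (F (picard F k' s x) - F (picard F m' s x)) \<le> L * (2 * (1 / 2) ^ i)" .
  qed (use Suc.prems in auto)
  from time_bound_le[OF this]
  have "norm (integral {0..t} (\<lambda>s. F (picard F k' s x) - F (picard F m' s x))) \<le> (h * L) * (2 * (1 / 2) ^ i)"
    using L0 Suc.prems by (auto simp: mult.assoc)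
  also have "\<dots> \<le> (1 / 2) * (2 * (1 / 2) ^ i)" using h(3) by (rule mult_right_mono) auto
  also have "integral {0..t} (\<lambda>s. F (picard F k' s x) - F (picard F m' s x)) = picard F k t x - picard F m t x"
    using Suc.prems by (subst Henstock_Kurzweil_Integration.integral_diff)
      (auto simp: km intro!: integrable_continuous_real continuous_on_picard_time)
  finally show ?case by simp
qed

text \<open>The derivatives satisfy an affine recursion with the same factor \<open>1 / 2\<close>, but its coefficients
\<open>F' (picard F k s x)\<close> vary with \<open>k\<close>. Since \<open>F'\<close> is merely continuous there is no rate for this, only an error
\<open>\<epsilon>\<close> valid from some \<open>N\<close> on, and \<open>4 * h * \<epsilon>\<close> is what the recursion accumulates from it.\<close>

lemma picard_deriv_cauchy:
  assumes "x \<in> ball 0 R" and "\<epsilon> \<ge> 0"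
    and "\<And>k m s. k \<ge> N \<Longrightarrow> m \<ge> N \<Longrightarrow> s \<in> {0..h} \<Longrightarrow> norm (F' (picard F k s x) - F' (picard F m s x)) \<le> \<epsilon>"
  shows "t \<in> {0..h} \<Longrightarrow> k \<ge> N + i \<Longrightarrow> m \<ge> N + i \<Longrightarrow>
    norm (picard_deriv F F' k t x - picard_deriv F F' m t x) \<le> 4 * h * \<epsilon> + 4 * (1 / 2) ^ i"
proof (induction i arbitrary: k m t)
  case 0
  have "norm (picard_deriv F F' k t x - picard_deriv F F' m t x) \<le> 4"
    using picard_deriv_bound[OF assms(1) 0(1), of k] picard_deriv_bound[OF assms(1) 0(1), of m]
      norm_triangle_ineq4[of "picard_deriv F F' k t x" "picard_deriv F F' m t x"] by simp
  also have "4 \<le> 4 * h * \<epsilon> + 4 * (1 / 2) ^ 0" using h assms by simp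
  finally show ?case .
next
  case (Suc i)
  let ?D = "picard_deriv F F'" and ?y = "\<lambda>k s. F' (picard F k s x)"
  let ?c = "4 * h * \<epsilon> + 4 * (1 / 2) ^ i"
  obtain k' m' where km: "k = Suc k'" "m = Suc m'" "k' \<ge> N + i" "m' \<ge> N + i"
    using Suc.prems by (metis Suc_le_D Suc_le_mono add_Suc_right)
  have c0: "?c \<ge> 0" using h assms by simp
  have "norm (integral {0..t} (\<lambda>s. (?y k' s o\<^sub>L ?D k' s x) - (?y m' s o\<^sub>L ?D m' s x))) \<le> (\<epsilon> * 2 + L * ?c) * (t - 0)"
  proof (intro integral_bound continuous_on_diff continuous_on_picard_time)
    fix s assume "s \<in> {0..t}"
    then have s: "s \<in> {0..h}" using Suc.prems by auto
    have split: "(?y k' s o\<^sub>L ?D k' s x) - (?y m' s o\<^sub>L ?D m' s x)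
        = ((?y k' s - ?y m' s) o\<^sub>L ?D k' s x) + (?y m' s o\<^sub>L (?D k' s x - ?D m' s x))"
      by (auto intro!: blinfun_eqI simp: blinfun.diff_left blinfun.add_left blinfun.diff_right)
    have "norm ((?y k' s o\<^sub>L ?D k' s x) - (?y m' s o\<^sub>L ?D m' s x))
        \<le> norm (?y k' s - ?y m' s) * norm (?D k' s x) + norm (?y m' s) * norm (?D k' s x - ?D m' s x)"
      unfolding split by (intro norm_triangle_mono norm_blinfun_compose)
    also have "\<dots> \<le> \<epsilon> * 2 + L * ?c"
    proof (intro add_mono mult_mono)
      show "norm (?y k' s - ?y m' s) \<le> \<epsilon>" using assms(3)[OF _ _ s] km(3,4) by simp
      show "norm (?D k' s x) \<le> 2" by (rule picard_deriv_bound[OF assms(1) s])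
      show "norm (?y m' s) \<le> L" by (rule bspec[OF L conjunct2[OF picard_near[OF assms(1) s]]])
      show "norm (?D k' s x - ?D m' s x) \<le> ?c" by (rule Suc.IH[OF s km(3,4)])
    qed (simp_all add: assms(2) L0)
    finally show "norm ((?y k' s o\<^sub>L ?D k' s x) - (?y m' s o\<^sub>L ?D m' s x)) \<le> \<epsilon> * 2 + L * ?c" .
  qed (use Suc.prems in auto)
  from time_bound_le[OF this]
  have "norm (integral {0..t} (\<lambda>s. (?y k' s o\<^sub>L ?D k' s x) - (?y m' s o\<^sub>L ?D m' s x))) \<le> 2 * h * \<epsilon> + (h * L) * ?c"
    using L0 Suc.prems assms(2) c0 by (auto simp: algebra_simps)
  also have "\<dots> \<le> 2 * h * \<epsilon> + (1 / 2) * ?c" using mult_right_mono[OF h(3) c0] by simp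
  also have "integral {0..t} (\<lambda>s. (?y k' s o\<^sub>L ?D k' s x) - (?y m' s o\<^sub>L ?D m' s x)) = ?D k t x - ?D m t x"
    using Suc.prems by (subst Henstock_Kurzweil_Integration.integral_diff)
      (auto simp: km intro!: integrable_continuous_real continuous_on_picard_time)
  finally show ?case by (simp add: algebra_simps)
qed

lemma picard_uniform_limit:
  obtains Y where "uniform_limit (ball 0 R \<times> {0..h}) (\<lambda>k (x, t). picard F k t x) Y sequentially"
proof -
  have "uniformly_Cauchy_on (ball 0 R \<times> {0..h}) (\<lambda>k (x, t). picard F k t x)"
  proof (rule uniformly_Cauchy_onI)
    fix e :: real assume "e > 0"
    then obtain N where "(1 / 2) ^ N < e / 2" using real_arch_pow_inv[of "e / 2" "1 / 2"] by auto
    then have "norm (picard F k t x - picard F m t x) < e"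
      if "x \<in> ball 0 R" "t \<in> {0..h}" "k \<ge> N" "m \<ge> N" for x t k m
      using picard_cauchy[OF that] by simp
    then show "\<exists>N. \<forall>p\<in>ball 0 R \<times> {0..h}. \<forall>k\<ge>N. \<forall>m\<ge>N.
        dist (case p of (x, t) \<Rightarrow> picard F k t x) (case p of (x, t) \<Rightarrow> picard F m t x) < e"
      by (intro exI[where x=N]) (auto simp: dist_norm)
  qed
  then show thesis
    using that uniformly_convergent_uniform_limit_iff Cauchy_uniformly_convergent by blast
qed

lemma picard_deriv_uniform_limit:
  obtains D where "uniform_limit (ball 0 R \<times> {0..h}) (\<lambda>k (x, t). picard_deriv F F' k t x) D sequentially"
proof -
  have "uniformly_Cauchy_on (ball 0 R \<times> {0..h}) (\<lambda>k (x, t). picard_deriv F F' k t x)"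
  proof (rule uniformly_Cauchy_onI)
    fix e :: real assume e: "e > 0"
    \<comment> \<open>The accumulated error \<open>4 * h * \<epsilon>\<close> and the geometric term must each stay below \<open>e / 2\<close>.\<close>
    define \<epsilon> where "\<epsilon> = e / (8 * (h + 1))"
    have \<epsilon>: "\<epsilon> > 0" "4 * h * \<epsilon> < e / 2" using e h by (auto simp: \<epsilon>_def field_simps)
    have "uniformly_continuous_on (cball 0 (R + 1)) F'"
      by (intro compact_uniformly_continuous continuous_on_subset[OF F'(2)]) auto
    then obtain \<delta> where \<delta>: "\<delta> > 0"
      "\<And>a b. a \<in> cball 0 (R + 1) \<Longrightarrow> b \<in> cball 0 (R + 1) \<Longrightarrow> dist a b < \<delta> \<Longrightarrow> dist (F' a) (F' b) < \<epsilon>"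
      using \<epsilon>(1) unfolding uniformly_continuous_on_def by metis
    obtain N where N: "(1 / 2) ^ N < \<delta> / 2" using real_arch_pow_inv[of "\<delta> / 2" "1 / 2"] \<delta>(1) by auto
    obtain i where i: "(1 / 2) ^ i < e / 8" using real_arch_pow_inv[of "e / 8" "1 / 2"] e by auto
    have "norm (picard_deriv F F' k t x - picard_deriv F F' m t x) < e"
      if "x \<in> ball 0 R" "t \<in> {0..h}" "k \<ge> N + i" "m \<ge> N + i" for x t k m
    proof -
      have "norm (picard_deriv F F' k t x - picard_deriv F F' m t x) \<le> 4 * h * \<epsilon> + 4 * (1 / 2) ^ i"
      proof (rule picard_deriv_cauchy[OF that(1) _ _ that(2-4)])
        fix k m s assume km: "k \<ge> N" "m \<ge> N" "s \<in> {0..h}"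
        have "dist (picard F k s x) (picard F m s x) < \<delta>"
          using picard_cauchy[OF that(1) km(3,1,2)] N by (simp add: dist_norm)
        from \<delta>(2)[OF _ _ this] picard_near[OF that(1) km(3)]
        show "norm (F' (picard F k s x) - F' (picard F m s x)) \<le> \<epsilon>"
          by (simp add: dist_norm less_imp_le)
      qed (use \<epsilon> in simp)
      then show ?thesis using \<epsilon>(2) i by simp
    qed
    then show "\<exists>N. \<forall>p\<in>ball 0 R \<times> {0..h}. \<forall>k\<ge>N. \<forall>m\<ge>N.
        dist (case p of (x, t) \<Rightarrow> picard_deriv F F' k t x) (case p of (x, t) \<Rightarrow> picard_deriv F F' m t x) < e"
      by (intro exI[where x="N + i"]) (auto simp: dist_norm)
  qed
  then show thesis
    using that uniformly_convergent_uniform_limit_iff Cauchy_uniformly_convergent by blast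
qed

lemma picard_limit_solves:
  assumes Y: "uniform_limit (ball 0 R \<times> {0..h}) (\<lambda>k (x, t). picard F k t x) Y sequentially"
    and x: "x \<in> ball 0 R"
  shows "solves_ivp F x h (\<lambda>t. Y (x, t))"
    and "t \<in> {0..h} \<Longrightarrow> Y (x, t) \<in> cball 0 (R + 1)"
proof -
  have ptw: "(\<lambda>k. picard F k t x) \<longlonglongrightarrow> Y (x, t)" if "t \<in> {0..h}" for t
    using tendsto_uniform_limitI[OF Y, of "(x, t)"] x that by simp
  show ball: "Y (x, t) \<in> cball 0 (R + 1)" if "t \<in> {0..h}" for t
    by (rule Lim_in_closed_set[OF closed_cball _ sequentially_bot ptw[OF that]])
       (use picard_near[OF x that] in \<open>auto intro!: always_eventually\<close>)
  have unif: "uniform_limit {0..h} (\<lambda>k t. picard F k t x) (\<lambda>t. Y (x, t)) sequentially"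
  proof -
    have "Pair x \<in> {0..h} \<rightarrow> ball 0 R \<times> {0..h}" using x by auto
    from uniform_limit_compose'[OF Y this] show ?thesis by simp
  qed
  have unifF: "uniform_limit {0..h} (\<lambda>k t. F (picard F k t x)) (\<lambda>t. F (Y (x, t))) sequentially"
  proof (rule uniform_limitI)
    fix e :: real assume e: "e > 0"
    have "\<forall>\<^sub>F k in sequentially. \<forall>t\<in>{0..h}. dist (picard F k t x) (Y (x, t)) < e / (L + 1)"
      using uniform_limitD[OF unif] e L0 by simp
    then show "\<forall>\<^sub>F k in sequentially. \<forall>t\<in>{0..h}. dist (F (picard F k t x)) (F (Y (x, t))) < e"
    proof (rule eventually_mono, safe)
      fix k t assume *: "\<forall>t\<in>{0..h}. dist (picard F k t x) (Y (x, t)) < e / (L + 1)" and t: "t \<in> {0..h}"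
      have "norm (F (picard F k t x) - F (Y (x, t))) \<le> L * norm (picard F k t x - Y (x, t))"
        using picard_near[OF x t] ball[OF t] by (intro F_lipschitz) auto
      also have "\<dots> \<le> L * (e / (L + 1))"
        using * t L0 by (intro mult_left_mono) (auto simp: dist_norm less_imp_le)
      also have "\<dots> < e" using e L0 by (simp add: field_simps)
      finally show "dist (F (picard F k t x)) (F (Y (x, t))) < e" by (simp add: dist_norm)
    qed
  qed
  have contF: "continuous_on {0..h} (\<lambda>t. F (Y (x, t)))"
    by (rule uniform_limit_theorem[OF _ unifF]) (auto intro!: always_eventually continuous_on_picard_time)
  have fixpoint: "Y (x, t) = x + integral {0..t} (\<lambda>s. F (Y (x, s)))" if t: "t \<in> {0..h}" for t
  proof -
    have "uniform_limit {0..t} (\<lambda>k t. F (picard F k t x)) (\<lambda>t. F (Y (x, t))) sequentially"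
      using uniform_limit_on_subset[OF unifF] t by auto
    then obtain I J where IJ: "\<And>k. ((\<lambda>s. F (picard F k s x)) has_integral I k) {0..t}"
      "((\<lambda>s. F (Y (x, s))) has_integral J) {0..t}" "I \<longlonglongrightarrow> J"
      by (rule uniform_limit_integral) (use continuous_on_picard_time t in auto)
    then have "(\<lambda>k. x + integral {0..t} (\<lambda>s. F (picard F k s x))) \<longlonglongrightarrow> x + integral {0..t} (\<lambda>s. F (Y (x, s)))"
      using integral_unique[OF IJ(1)] integral_unique[OF IJ(2)] by (auto intro!: tendsto_intros)
    then have "(\<lambda>k. picard F (Suc k) t x) \<longlonglongrightarrow> x + integral {0..t} (\<lambda>s. F (Y (x, s)))" by simp
    with LIMSEQ_Suc[OF ptw[OF t]] show ?thesis by (rule LIMSEQ_unique)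
  qed
  have "((\<lambda>t. Y (x, t)) has_vector_derivative F (Y (x, t))) (at t within {0..h})" if t: "t \<in> {0..h}" for t
  proof (rule has_vector_derivative_transform[OF t fixpoint])
    show "((\<lambda>t. x + integral {0..t} (\<lambda>s. F (Y (x, s)))) has_vector_derivative F (Y (x, t))) (at t within {0..h})"
      using has_vector_derivative_add[OF has_vector_derivative_const integral_has_vector_derivative[OF contF t]]
      by simp
  qed
  then show "solves_ivp F x h (\<lambda>t. Y (x, t))"
    using h fixpoint[of 0] by (simp add: solves_ivp_iff)
qed

text \<open>Uniform convergence of the derivatives identifies the derivative of the limit, and uniform
limits of continuous functions are continuous.\<close>

lemma picard_limit_C1:
  assumes Y: "uniform_limit (ball 0 R \<times> {0..h}) (\<lambda>k (x, t). picard F k t x) Y sequentially"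
    and t: "t \<in> {0..h}"
  shows "C1_on (ball 0 R) (\<lambda>x. Y (x, t))"
proof (cases "ball (0 :: 'a) R = {}")
  case False
  then obtain x0 :: 'a where x0: "x0 \<in> ball 0 R" by blast
  obtain D where D: "uniform_limit (ball 0 R \<times> {0..h}) (\<lambda>k (x, t). picard_deriv F F' k t x) D sequentially"
    by (rule picard_deriv_uniform_limit)
  have ptw: "(\<lambda>k. picard F k t x) \<longlonglongrightarrow> Y (x, t)" if "x \<in> ball 0 R" for x
    using tendsto_uniform_limitI[OF Y, of "(x, t)"] t that by simp
  have unif: "uniform_limit (ball 0 R) (\<lambda>k x. picard_deriv F F' k t x) (\<lambda>x. D (x, t)) sequentially"
  proof -
    have "(\<lambda>x::'a. (x, t)) \<in> ball 0 R \<rightarrow> ball 0 R \<times> {0..h}" using t by auto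
    from uniform_limit_compose'[OF D this] show ?thesis by simp
  qed
  have "continuous_on (ball 0 R) (\<lambda>x. D (x, t))"
  proof (rule uniform_limit_theorem[OF _ unif])
    have pair: "continuous_on (ball 0 R) (\<lambda>x::'a. (x, t))" "(\<lambda>x::'a. (x, t)) ` ball 0 R \<subseteq> UNIV \<times> {0..h}"
      using t by (auto intro!: continuous_intros)
    have "continuous_on (ball 0 R) (\<lambda>x. picard_deriv F F' k t x)" for k
      using continuous_on_compose2[OF continuous_on_picard_deriv pair] by simp
    then show "\<forall>\<^sub>F k in sequentially. continuous_on (ball 0 R) (\<lambda>x. picard_deriv F F' k t x)"
      by simp
  qed auto
  moreover have "\<exists>g. \<forall>x\<in>ball 0 R. (\<lambda>k. picard F k t x) \<longlonglongrightarrow> g x \<and>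
      (g has_derivative blinfun_apply (D (x, t))) (at x within ball 0 R)"
  proof (rule has_derivative_sequence)
    show "convex (ball (0 :: 'a) R)" "x0 \<in> ball 0 R" by (fact convex_ball x0)+
    show "(\<lambda>k. picard F k t x0) \<longlonglongrightarrow> Y (x0, t)" by (rule ptw[OF x0])
    show "(picard F k t has_derivative blinfun_apply (picard_deriv F F' k t x)) (at x within ball 0 R)" for k x
      using picard_has_derivative[OF t] has_derivative_at_withinI by blast
    fix e :: real assume "e > 0"
    from uniform_limitD[OF unif this]
    show "\<forall>\<^sub>F k in sequentially. \<forall>x\<in>ball 0 R. \<forall>v.
        norm (blinfun_apply (picard_deriv F F' k t x) v - blinfun_apply (D (x, t)) v) \<le> e * norm v"
    proof (rule eventually_mono, safe)
      fix k and x v :: 'a assume "\<forall>x\<in>ball 0 R. dist (picard_deriv F F' k t x) (D (x, t)) < e" "x \<in> ball 0 R"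
      then have "norm (picard_deriv F F' k t x - D (x, t)) \<le> e" by (auto simp: dist_norm less_imp_le)
      then have "norm (picard_deriv F F' k t x - D (x, t)) * norm v \<le> e * norm v" by (rule mult_right_mono) auto
      then show "norm (blinfun_apply (picard_deriv F F' k t x) v - blinfun_apply (D (x, t)) v) \<le> e * norm v"
        using norm_blinfun[of "picard_deriv F F' k t x - D (x, t)" v] by (simp add: blinfun.diff_left)
    qed
  qed
  then obtain g where g: "\<And>x. x \<in> ball 0 R \<Longrightarrow> (\<lambda>k. picard F k t x) \<longlonglongrightarrow> g x"
    "\<And>x. x \<in> ball 0 R \<Longrightarrow> (g has_derivative blinfun_apply (D (x, t))) (at x within ball 0 R)" by blast
  have "((\<lambda>x. Y (x, t)) has_derivative blinfun_apply (D (x, t))) (at x)" if x: "x \<in> ball 0 R" for x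
  proof (rule has_derivative_transform_within_open[OF _ open_ball x])
    show "(g has_derivative blinfun_apply (D (x, t))) (at x)"
      using g(2)[OF x] by (simp add: at_within_open[OF x open_ball])
    show "g z = Y (z, t)" if "z \<in> ball 0 R" for z
      by (rule LIMSEQ_unique[OF g(1)[OF that] ptw[OF that]])
  qed
  ultimately show ?thesis
    unfolding C1_on_def by (intro exI[where x="\<lambda>x. D (x, t)"]) simp
next
  case True
  show ?thesis unfolding C1_on_def True by simp
qed

end

lemma short_time_flow:
  fixes F :: "'a::euclidean_space \<Rightarrow> 'a"
  assumes "C1_on UNIV F"
  obtains h where "h > 0" "\<And>x. x \<in> ball 0 R \<Longrightarrow> flow_exists F h x"
    "\<And>x t. x \<in> ball 0 R \<Longrightarrow> t \<in> {0..h} \<Longrightarrow> flow F t x \<in> cball 0 (R + 1)"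
    "C1_on (ball 0 R) (flow F h)"
proof -
  obtain F' where F': "\<And>x. (F has_derivative blinfun_apply (F' x)) (at x)" "continuous_on UNIV F'"
    using assms unfolding C1_on_def by blast
  have "compact (F ` cball 0 (R + 1))" "compact (F' ` cball 0 (R + 1))"
    using C1_on_imp_continuous_on[OF assms] F'(2)
    by (intro compact_continuous_image compact_cball; blast intro: continuous_on_subset)+
  then obtain M L where M: "M > 0" "\<forall>x\<in>cball 0 (R + 1). norm (F x) \<le> M"
    and L: "L > 0" "\<forall>x\<in>cball 0 (R + 1). norm (F' x) \<le> L"
    using compact_imp_bounded bounded_pos by (metis image_eqI)
  \<comment> \<open>The first bound confines the iterates, the second makes the iteration a contraction.\<close>
  define h where "h = min (1 / M) (1 / (2 * L))"
  have h: "h > 0" "h * M \<le> 1" "h * L \<le> 1 / 2"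
    using M(1) L(1) by (auto simp: h_def min_def field_simps)
  note ctx = F' M(2) L(2) less_imp_le[OF h(1)] h(2,3) less_imp_le[OF L(1)]
  obtain Y where Y: "uniform_limit (ball 0 R \<times> {0..h}) (\<lambda>k (x, t). picard F k t x) Y sequentially"
    using picard_uniform_limit[OF ctx] by blast
  note sol = picard_limit_solves[OF ctx Y]
  have Yflow: "Y (x, t) = flow F t x" if "x \<in> ball 0 R" "t \<in> {0..h}" for x t
    using flow_eq_on[OF assms sol(1)[OF that(1)]] that(2) by simp
  show thesis
  proof
    show "flow_exists F h x" if "x \<in> ball 0 R" for x using sol(1)[OF that] unfolding flow_exists_def by blast
    show "flow F t x \<in> cball 0 (R + 1)" if "x \<in> ball 0 R" "t \<in> {0..h}" for x t
      using sol(2)[OF that] Yflow[OF that] by simp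
    have "C1_on (ball 0 R) (\<lambda>x. Y (x, h))" using picard_limit_C1[OF ctx Y] h by auto
    then show "C1_on (ball 0 R) (flow F h)"
      by (rule C1_on_cong[OF open_ball]) (use Yflow h(1) in simp)
  qed (fact h(1))
qed

section \<open>A Lyapunov form for a Hurwitz matrix\<close>

text \<open>Summing the recursion gives \<open>(1 - \<rho>) * (\<Sum>k<n. a k) \<le> a 0 + suminf b\<close> for every \<open>n\<close>.\<close>

lemma summable_of_contracting_recursion:
  fixes a b :: "nat \<Rightarrow> real"
  assumes "\<And>k. 0 \<le> a k" "\<And>k. 0 \<le> b k" "summable b" "0 \<le> \<rho>" "\<rho> < 1"
    and rec: "\<And>k. a (Suc k) \<le> \<rho> * a k + b k"
  shows "summable a"
proof (rule summableI_nonneg_bounded)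
  fix n
  have "(\<Sum>k<n. a k) \<le> (\<Sum>k<Suc n. a k)" using assms(1) by simp
  also have "\<dots> = a 0 + (\<Sum>k<n. a (Suc k))" by (rule sum.lessThan_Suc_shift)
  also have "(\<Sum>k<n. a (Suc k)) \<le> (\<Sum>k<n. \<rho> * a k + b k)" by (intro sum_mono rec)
  also have "\<dots> = \<rho> * (\<Sum>k<n. a k) + (\<Sum>k<n. b k)" by (simp add: sum.distrib sum_distrib_left)
  also have "(\<Sum>k<n. b k) \<le> suminf b" using assms by (intro sum_le_suminf) auto
  finally have "(1 - \<rho>) * (\<Sum>k<n. a k) \<le> a 0 + suminf b" by (simp add: algebra_simps)
  then show "(\<Sum>k<n. a k) \<le> (a 0 + suminf b) / (1 - \<rho>)"
    using assms by (simp add: field_simps)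
qed (use assms in simp)

lemma norm_vector_scalar_mult: "norm (c *s (v :: complex^'n)) = cmod c * norm v"
  by (simp add: norm_vec_def norm_mult L2_set_right_distrib)

text \<open>This is \<open>p(T)\<close> applied to \<open>v\<close>.\<close>

definition poly_action :: "(complex^'n \<Rightarrow> complex^'n) \<Rightarrow> complex poly \<Rightarrow> complex^'n \<Rightarrow> complex^'n" where
  "poly_action T p v = (\<Sum>k\<le>degree p. coeff p k *s (T ^^ k) v)"

lemma poly_action_upto:
  assumes "degree p \<le> N" shows "poly_action T p v = (\<Sum>k\<le>N. coeff p k *s (T ^^ k) v)"
  unfolding poly_action_def
  by (rule sum.mono_neutral_left) (use assms in \<open>auto simp: coeff_eq_0\<close>)

lemma poly_action_add: "poly_action T (p + q) v = poly_action T p v + poly_action T q v"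
proof -
  define N where "N = max (degree p) (degree q)"
  have "degree p \<le> N" "degree q \<le> N" "degree (p + q) \<le> N"
    by (auto simp: N_def degree_add_le)
  then show ?thesis by (simp add: poly_action_upto vector_sadd_rdistrib sum.distrib)
qed

lemma poly_action_smult: "poly_action T (smult c p) v = c *s poly_action T p v"
  by (simp add: poly_action_upto[where N="degree p"] degree_smult_le vec.scale_sum_right)

lemma poly_action_pCons_0: "poly_action T (pCons 0 p) v = poly_action T p (T v)"
proof -
  have "poly_action T (pCons 0 p) v = (\<Sum>k\<le>Suc (degree p). coeff (pCons 0 p) k *s (T ^^ k) v)"
    by (rule poly_action_upto) (simp add: degree_pCons_le)
  also have "\<dots> = (\<Sum>k\<le>degree p. coeff p k *s (T ^^ k) (T v))"
    by (subst sum.atMost_Suc_shift) (simp add: funpow_swap1)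
  finally show ?thesis by (simp add: poly_action_def)
qed

context
  fixes T :: "complex^'n \<Rightarrow> complex^'n"
  assumes T_add: "\<And>v w. T (v + w) = T v + T w" and T_scale: "\<And>c v. T (c *s v) = c *s T v"
begin

lemma funpow_add_scale:
  "(T ^^ k) (v + w) = (T ^^ k) v + (T ^^ k) w" "(T ^^ k) (c *s v) = c *s (T ^^ k) v"
  by (induction k) (simp_all add: T_add T_scale)

lemma poly_action_linear:
  "poly_action T p (v + w) = poly_action T p v + poly_action T p w"
  "poly_action T p (c *s v) = c *s poly_action T p v"
  by (simp_all add: poly_action_def funpow_add_scale vector_add_ldistrib sum.distrib
      vec.scale_sum_right vector_smult_assoc mult.commute)

lemma poly_action_inner_factor:
  "poly_action T ([:- \<mu>, 1:] * p) v = poly_action T p (T v + (- \<mu>) *s v)"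
proof -
  have "[:- \<mu>, 1:] * p = smult (- \<mu>) p + pCons 0 p" by simp
  then show ?thesis
    by (simp only: poly_action_add poly_action_smult poly_action_pCons_0 poly_action_linear add.commute)
qed

lemma poly_action_outer_factor:
  "poly_action T ([:- \<mu>, 1:] * p) v = T (poly_action T p v) + (- \<mu>) *s poly_action T p v"
proof -
  have T0: "T 0 = 0" using T_scale[of 0 0] by simp
  have T_sum: "T (sum g {..n}) = (\<Sum>k\<le>n. T (g k))" for g :: "nat \<Rightarrow> complex^'n" and n
    by (induction n) (simp_all add: T_add)
  have "poly_action T p (T v) = T (poly_action T p v)"
    by (simp add: poly_action_def T_sum T_scale funpow_swap1)
  then show ?thesis by (simp only: poly_action_inner_factor poly_action_linear)
qed

lemma poly_action_eigenvector:
  assumes "T v = \<mu> *s v" shows "poly_action T p v = poly p \<mu> *s v"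
proof -
  have "(T ^^ k) v = \<mu> ^ k *s v" for k
    by (induction k) (simp_all add: T_scale assms vector_smult_assoc mult.commute)
  then show ?thesis
    by (simp add: poly_action_def poly_altdef vector_smult_assoc vec.scale_sum_left)
qed

text \<open>Induction on the degree of an annihilating polynomial, splitting off a root \<open>\<mu>\<close>. If \<open>\<mu>\<close> is an
eigenvalue, the Euler step \<open>w + h *s T w\<close> acts on \<open>v\<close> as \<open>1 + h * \<mu>\<close>, which has modulus less than 1, up to
\<open>u = T v - \<mu> *s v\<close>; and \<open>u\<close> is annihilated by the cofactor. If \<open>\<mu>\<close> is not an eigenvalue,
\<open>T - \<mu>\<close> is injective and the factor can be dropped.\<close>

lemma summable_iterates:
  assumes h: "\<And>\<mu> w. w \<noteq> 0 \<Longrightarrow> T w = \<mu> *s w \<Longrightarrow> cmod (1 + h * \<mu>) < 1"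
  shows "p \<noteq> 0 \<Longrightarrow> poly_action T p v = 0 \<Longrightarrow> summable (\<lambda>k. norm (((\<lambda>w. w + h *s T w) ^^ k) v))"
proof (induction "degree p" arbitrary: p v)
  case 0
  then obtain c where "p = [:c:]" "c \<noteq> 0" by (metis degree_eq_zeroE pCons_eq_0_iff)
  with 0(3) have "v = 0" by (simp add: poly_action_def)
  have "((\<lambda>w. w + h *s T w) ^^ k) 0 = 0" for k
    using T_scale[of 0 0] by (induction k) simp_all
  then show ?case using \<open>v = 0\<close> by simp
next
  case (Suc d)
  let ?M = "\<lambda>w. w + h *s T w"
  have M: "(?M ^^ k) (a + b) = (?M ^^ k) a + (?M ^^ k) b" "(?M ^^ k) (c *s a) = c *s (?M ^^ k) a" for k a b c
    by (induction k) (simp_all add: T_add T_scale vector_add_ldistrib vector_smult_assoc mult.commute)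
  obtain \<mu> where "poly p \<mu> = 0"
    using fundamental_theorem_of_algebra[of p] Suc(2) by (auto simp: constant_degree)
  then obtain q where q: "p = [:- \<mu>, 1:] * q" unfolding poly_eq_0_iff_dvd by (rule dvdE)
  have q0: "q \<noteq> 0" using Suc(3) q by auto
  then have dq: "d = degree q" using Suc(2) by (simp add: q degree_mult_eq del: mult_pCons_left)
  show ?case
  proof (cases "\<exists>w. w \<noteq> 0 \<and> T w = \<mu> *s w")
    case True
    then have \<rho>: "cmod (1 + h * \<mu>) < 1" using h by blast
    define u where "u = T v + (- \<mu>) *s v"
    have "poly_action T q u = 0"
      using Suc(4) unfolding q u_def by (simp only: poly_action_inner_factor)
    then have su: "summable (\<lambda>k. norm ((?M ^^ k) u))" by (rule Suc(1)[OF dq q0])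
    have "?M v = (1 + h * \<mu>) *s v + h *s u"
      by (simp add: u_def vec_eq_iff algebra_simps)
    then have "(?M ^^ Suc k) v = (1 + h * \<mu>) *s (?M ^^ k) v + h *s (?M ^^ k) u" for k
      by (simp only: funpow_Suc_right o_apply M)
    then have rec: "norm ((?M ^^ Suc k) v) \<le> cmod (1 + h * \<mu>) * norm ((?M ^^ k) v) + cmod h * norm ((?M ^^ k) u)" for k
      using norm_triangle_ineq[of "(1 + h * \<mu>) *s (?M ^^ k) v" "h *s (?M ^^ k) u"]
      by (simp only: norm_vector_scalar_mult)
    show ?thesis
      by (rule summable_of_contracting_recursion[OF _ _ summable_mult[OF su] _ \<rho> rec]) simp_all
  next
    case False
    have "T (poly_action T q v) + (- \<mu>) *s poly_action T q v = 0"
      using Suc(4) unfolding q by (simp only: poly_action_outer_factor)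
    then have "T (poly_action T q v) = \<mu> *s poly_action T q v"
      by (simp add: vec_eq_iff)
    with False have "poly_action T q v = 0" by blast
    then show ?thesis by (rule Suc(1)[OF dq q0])
  qed
qed

end

text \<open>The powers of \<open>A\<close> up to the dimension of the space of matrices are too many to be independent.\<close>

lemma matrix_annihilating_relation:
  fixes A :: "real^'n^'n"
  shows "\<exists>(c :: nat \<Rightarrow> real) N. (\<exists>k\<le>N. c k \<noteq> 0) \<and> (\<forall>v. (\<Sum>k\<le>N. c k *\<^sub>R ((*v) A ^^ k) v) = 0)"
proof -
  define P where "P k = ((**) A ^^ k) (mat 1)" for k
  define N where "N = DIM(real^'n^'n)"
  have P: "P k *v v = ((*v) A ^^ k) v" for k v
    by (induction k) (simp_all add: P_def flip: matrix_vector_mul_assoc)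
  have "\<exists>c. (\<exists>k\<le>N. c k \<noteq> 0) \<and> (\<Sum>k\<le>N. c k *\<^sub>R P k) = 0"
  proof (cases "inj_on P {..N}")
    case True
    have "dependent (P ` {..N})"
      by (rule dependent_biggerset) (simp add: card_image[OF True], simp add: N_def)
    then obtain u where u: "\<exists>v\<in>P ` {..N}. u v \<noteq> 0" "(\<Sum>v\<in>P ` {..N}. u v *\<^sub>R v) = 0"
      using real_vector.dependent_finite[of "P ` {..N}"] by auto
    then show ?thesis
      by (intro exI[where x="\<lambda>k. u (P k)"]) (auto simp: sum.reindex[OF True])
  next
    case False
    \<comment> \<open>Two coinciding powers give the relation \<open>P i - P j = 0\<close>.\<close>
    then obtain i j where ij: "i \<le> N" "j \<le> N" "i \<noteq> j" "P i = P j" by (auto simp: inj_on_def)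
    define c where "c k = (if k = i then 1 else if k = j then -1 else 0 :: real)" for k
    have "(\<Sum>k\<le>N. c k *\<^sub>R P k) = (\<Sum>k\<in>{i, j}. c k *\<^sub>R P k)"
      by (rule sum.mono_neutral_right) (use ij in \<open>auto simp: c_def\<close>)
    also have "\<dots> = 0" using ij by (simp add: c_def)
    finally show ?thesis using ij(1) by (intro exI[where x=c]) (auto simp: c_def)
  qed
  then obtain c where c: "\<exists>k\<le>N. c k \<noteq> 0" "(\<Sum>k\<le>N. c k *\<^sub>R P k) = 0" by blast
  have "(\<Sum>k\<le>N. c k *\<^sub>R ((*v) A ^^ k) v) = 0" for v
  proof -
    have "(\<Sum>k\<le>n. c k *\<^sub>R P k) *v v = (\<Sum>k\<le>n. c k *\<^sub>R (P k *v v))" for n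
      by (induction n) (simp_all add: matrix_vector_mult_add_rdistrib scaleR_matrix_vector_assoc)
    from this[of N] show ?thesis by (simp add: P c(2))
  qed
  with c(1) show ?thesis by blast
qed

lemma eventually_euler_factor_less_1:
  assumes "Re \<mu> < 0"
  shows "\<forall>\<^sub>F h in at_right (0::real). cmod (1 + of_real h * \<mu>) < 1"
proof -
  have pos: "(cmod \<mu>)\<^sup>2 > 0" using assms by auto
  have "cmod (1 + of_real h * \<mu>) < 1" if h: "0 < h" "h < - 2 * Re \<mu> / (cmod \<mu>)\<^sup>2" for h :: real
  proof -
    have "h * (cmod \<mu>)\<^sup>2 < - 2 * Re \<mu>" using h(2) pos by (simp add: field_simps)
    then have "h * (h * (cmod \<mu>)\<^sup>2) < h * (- 2 * Re \<mu>)" using h(1) by (rule mult_strict_left_mono)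
    moreover have "(cmod (1 + of_real h * \<mu>))\<^sup>2 = 1 + 2 * h * Re \<mu> + h\<^sup>2 * (cmod \<mu>)\<^sup>2"
      by (simp only: cmod_power2) (simp add: power2_eq_square algebra_simps)
    ultimately have "(cmod (1 + of_real h * \<mu>))\<^sup>2 < 1\<^sup>2" by (simp add: power2_eq_square algebra_simps)
    then show ?thesis by (rule power2_less_imp_less) simp
  qed
  moreover have "- 2 * Re \<mu> / (cmod \<mu>)\<^sup>2 > 0" using assms pos by (simp add: field_simps)
  ultimately show ?thesis unfolding eventually_at_right_field by blast
qed


text \<open>One polynomial \<open>p\<close> with \<open>p(A) = 0\<close> confines the eigenvalues to its finitely many roots, so a single step size
\<open>h\<close> serves them all.\<close>

lemma hurwitz_discrete_stability:
  fixes A :: "real^'n^'n"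
  assumes "hurwitz A"
  shows "\<exists>h>0. \<forall>v. summable (\<lambda>k. norm (((\<lambda>w. w + h *\<^sub>R (A *v w)) ^^ k) v))"
proof -
  define T where "T v = map_matrix complex_of_real A *v v" for v :: "complex^'n"
  define emb :: "real^'n \<Rightarrow> complex^'n" where "emb v = (\<chi> i. complex_of_real (v $ i))" for v
  have T_add: "T (v + w) = T v + T w" and T_scale: "T (c *s v) = c *s T v" for v w c
    by (simp_all add: T_def matrix_vector_right_distrib vector_scalar_commute)
  have emb_lin: "emb (v + w) = emb v + emb w" "emb (c *\<^sub>R v) = of_real c *s emb v" "emb 0 = 0" for v w c
    by (simp_all add: emb_def vec_eq_iff)
  have emb_sum: "emb (\<Sum>k\<le>n. g k) = (\<Sum>k\<le>n. emb (g k))" for g and n :: nat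
    by (induction n) (simp_all add: emb_lin)
  have norm_emb: "norm (emb v) = norm v" for v by (simp add: emb_def norm_vec_def)
  have T_emb: "T (emb v) = emb (A *v v)" for v
    by (simp add: T_def emb_def vec_eq_iff matrix_vector_mult_def map_matrix_def)
  have T_pow: "(T ^^ k) (emb v) = emb (((*v) A ^^ k) v)" for k v
    by (induction k) (simp_all add: T_emb)
  obtain c where "\<exists>N. (\<exists>k\<le>N. c k \<noteq> 0) \<and> (\<forall>v. (\<Sum>k\<le>N. c k *\<^sub>R ((*v) A ^^ k) v) = 0)"
    using matrix_annihilating_relation[of A] by (rule exE)
  then obtain N where N: "(\<exists>k\<le>N. c k \<noteq> 0) \<and> (\<forall>v. (\<Sum>k\<le>N. c k *\<^sub>R ((*v) A ^^ k) v) = 0)"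
    by (rule exE)
  note c = conjunct1[OF N] conjunct2[OF N]
  define p where "p = (\<Sum>k\<le>N. monom (complex_of_real (c k)) k)"
  have coeff_p: "coeff p k = (if k \<le> N then complex_of_real (c k) else 0)" for k
    by (simp add: p_def coeff_sum)
  then have "p \<noteq> 0" using c(1) by (metis coeff_0 of_real_eq_0_iff)
  have "degree p \<le> N" by (rule degree_le) (simp add: coeff_p)
  then have p_emb: "poly_action T p (emb v) = 0" for v
  proof -
    have "poly_action T p (emb v) = (\<Sum>k\<le>N. coeff p k *s (T ^^ k) (emb v))"
      by (rule poly_action_upto) fact
    also have "\<dots> = emb (\<Sum>k\<le>N. c k *\<^sub>R ((*v) A ^^ k) v)"
      by (simp add: coeff_p T_pow emb_sum emb_lin)
    also have "\<dots> = 0" by (simp only: spec[OF c(2)] emb_lin)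
    finally show ?thesis .
  qed
  \<comment> \<open>Real and imaginary parts: a relation for the real matrix holds on all of \<open>complex^'n\<close>.\<close>
  have p_ann: "poly_action T p w = 0" for w
  proof -
    have "w = emb (\<chi> i. Re (w $ i)) + \<i> *s emb (\<chi> i. Im (w $ i))"
      by (simp add: vec_eq_iff emb_def complex_eq)
    then obtain a b where "w = emb a + \<i> *s emb b" by blast
    then show ?thesis
      by (simp add: poly_action_linear[OF T_add T_scale] p_emb)
  qed
  have eig: "Re \<mu> < 0 \<and> poly p \<mu> = 0" if "w \<noteq> 0" "T w = \<mu> *s w" for w \<mu>
  proof
    show "Re \<mu> < 0" using assms that unfolding hurwitz_def T_def by blast
    have "poly p \<mu> *s w = 0"
      using poly_action_eigenvector[OF T_add T_scale that(2), of p] p_ann by simp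
    with that(1) show "poly p \<mu> = 0" by simp
  qed
  have "finite {\<mu>. poly p \<mu> = 0 \<and> Re \<mu> < 0}"
    by (rule finite_subset[OF _ poly_roots_finite[OF \<open>p \<noteq> 0\<close>]]) auto
  then have "\<forall>\<^sub>F h in at_right (0::real). \<forall>\<mu>\<in>{\<mu>. poly p \<mu> = 0 \<and> Re \<mu> < 0}. cmod (1 + of_real h * \<mu>) < 1"
    by (rule eventually_ball_finite) (auto intro: eventually_euler_factor_less_1)
  then obtain b :: real where "b > 0"
    "\<forall>h>0. h < b \<longrightarrow> (\<forall>\<mu>\<in>{\<mu>. poly p \<mu> = 0 \<and> Re \<mu> < 0}. cmod (1 + of_real h * \<mu>) < 1)"
    unfolding eventually_at_right_field by blast
  then obtain h :: real where h: "h > 0" "\<forall>\<mu>. poly p \<mu> = 0 \<and> Re \<mu> < 0 \<longrightarrow> cmod (1 + of_real h * \<mu>) < 1"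
    using field_lbound_gt_zero[of b b] by blast
  have pow: "((\<lambda>w. w + of_real h *s T w) ^^ k) (emb v) = emb (((\<lambda>w. w + h *\<^sub>R (A *v w)) ^^ k) v)" for k v
    by (induction k) (simp_all add: T_emb emb_lin)
  have summ: "summable (\<lambda>k. norm (((\<lambda>w. w + of_real h *s T w) ^^ k) (emb v)))" for v
    by (rule summable_iterates[OF T_add T_scale _ \<open>p \<noteq> 0\<close> p_emb]) (use eig h(2) in blast)
  have "\<forall>v. summable (\<lambda>k. norm (((\<lambda>w. w + h *\<^sub>R (A *v w)) ^^ k) v))"
    by (rule allI) (rule summ[unfolded pow norm_emb])
  with h(1) show ?thesis by (intro exI[where x=h] conjI)
qed

text \<open>Shifting the sum that defines \<open>B\<close> gives \<open>B (M v) (M v) = B v v - v \<bullet> v\<close> for the Euler step \<open>M v = v + h A v\<close>.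
Expanding the left side, \<open>2 * h * B v (A v) = - (v \<bullet> v) - h\<^sup>2 * B (A v) (A v)\<close>, and the last term only helps:
the Lyapunov form of the Euler discretization is one for the differential equation.\<close>

lemma hurwitz_lyapunov_form:
  fixes A :: "real^'n^'n"
  assumes "hurwitz A"
  obtains B :: "real^'n \<Rightarrow> real^'n \<Rightarrow> real" and c where "bounded_bilinear B" "\<And>u v. B u v = B v u"
    "\<And>v. v \<bullet> v \<le> B v v" "c > 0" "\<And>v. B v (A *v v) \<le> - c * (v \<bullet> v)"
proof -
  obtain h where h: "h > 0" "\<forall>v. summable (\<lambda>k. norm (((\<lambda>w. w + h *\<^sub>R (A *v w)) ^^ k) v))"
    using hurwitz_discrete_stability[OF assms] by (elim exE conjE)
  define M where "M w = w + h *\<^sub>R (A *v w)" for w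
  have h_M: "summable (\<lambda>k. norm ((M ^^ k) v))" for v
    using spec[OF h(2), of v] unfolding M_def[abs_def] .
  have M_pow: "(M ^^ k) (v + w) = (M ^^ k) v + (M ^^ k) w" "(M ^^ k) (r *\<^sub>R v) = r *\<^sub>R (M ^^ k) v" for k v w r
    by (induction k) (simp_all add: M_def algebra_simps matrix_vector_mult_scaleR)
  define B where "B u v = (\<Sum>k. (M ^^ k) u \<bullet> (M ^^ k) v)" for u v
  have summ: "summable (\<lambda>k. (M ^^ k) u \<bullet> (M ^^ k) v)" for u v
  proof -
    have "Bseq (\<lambda>k. norm ((M ^^ k) u))" using h_M summable_imp_Bseq by blast
    then obtain C where C: "\<And>k. norm ((M ^^ k) u) \<le> C" by (auto simp: Bseq_def)
    have bound: "norm ((M ^^ k) u \<bullet> (M ^^ k) v) \<le> C * norm ((M ^^ k) v)" for k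
    proof -
      have "norm ((M ^^ k) u \<bullet> (M ^^ k) v) \<le> norm ((M ^^ k) u) * norm ((M ^^ k) v)"
        by (simp add: Cauchy_Schwarz_ineq2)
      also have "\<dots> \<le> C * norm ((M ^^ k) v)" by (intro mult_right_mono C norm_ge_zero)
      finally show ?thesis .
    qed
    show ?thesis
      by (rule summable_comparison_test'[OF summable_mult[OF h_M[of v], of C], of 0]) (rule bound)
  qed
  have B_add: "B (u + u') v = B u v + B u' v" for u u' v
    unfolding B_def using suminf_add[OF summ summ] by (simp add: M_pow inner_add_left)
  have B_scale: "B (r *\<^sub>R u) v = r *\<^sub>R B u v" for r u v
    unfolding B_def using suminf_mult[OF summ] by (simp add: M_pow)
  have B_sym: "B u v = B v u" for u v
    by (simp add: B_def inner_commute)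
  have "bilinear B"
    unfolding bilinear_def
  proof (intro conjI allI linearI)
    show "B u (v + w) = B u v + B u w" for u v w
      using B_add[of v w u] by (simp add: B_sym[of u])
    show "B u (r *\<^sub>R v) = r *\<^sub>R B u v" for u v r
      using B_scale[of r v u] by (simp add: B_sym[of u])
  qed (simp_all add: B_add B_scale)
  then interpret B: bounded_bilinear B by (simp add: bilinear_conv_bounded_bilinear)
  have ge: "v \<bullet> v \<le> B v v" for v
    unfolding B_def using sum_le_suminf[OF summ, of "{0}" v v] by simp
  have telescope: "B (M v) (M v) = B v v - v \<bullet> v" for v
    using suminf_split_head[OF summ[of v v]] by (simp add: B_def funpow_swap1)
  have dissip: "B v (A *v v) \<le> - (1 / (2 * h)) * (v \<bullet> v)" for v
  proof -
    have "B (M v) (M v) = B v v + 2 * h * B v (A *v v) + h\<^sup>2 * B (A *v v) (A *v v)"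
      by (simp add: M_def B.add_left B.add_right B.scaleR_left B.scaleR_right B_sym[of "A *v v" v]
          power2_eq_square algebra_simps)
    moreover have "B (A *v v) (A *v v) \<ge> 0" using ge[of "A *v v"] inner_ge_zero[of "A *v v"] by linarith
    then have "h\<^sup>2 * B (A *v v) (A *v v) \<ge> 0" by simp
    ultimately have "2 * h * B v (A *v v) \<le> - (v \<bullet> v)" using telescope[of v] by linarith
    then show ?thesis using h(1) by (simp add: field_simps)
  qed
  show thesis
  proof (rule that)
    show "bounded_bilinear B" by (fact B.bounded_bilinear_axioms)
    show "B u v = B v u" for u v by (fact B_sym)
    show "v \<bullet> v \<le> B v v" for v by (fact ge)
    show "B v (A *v v) \<le> - (1 / (2 * h)) * (v \<bullet> v)" for v by (fact dissip)
    show "1 / (2 * h) > 0" using h(1) by simp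
  qed
qed

section \<open>Series of continuously differentiable functions\<close>

text \<open>The derivative in direction \<open>v\<close> is a limit of difference quotients bounded by \<open>M * norm v\<close>.\<close>

lemma norm_derivative_le_lipschitz:
  fixes g :: "'a::real_normed_vector \<Rightarrow> real"
  assumes "open U" "x \<in> U" and g': "(g has_derivative blinfun_apply D) (at x)"
    and lip: "\<And>y. y \<in> U \<Longrightarrow> \<bar>g y - g x\<bar> \<le> M * norm (y - x)" and "M \<ge> 0"
  shows "norm D \<le> M"
proof (rule norm_blinfun_bound[OF \<open>M \<ge> 0\<close>])
  fix v
  have line: "((\<lambda>t. x + t *\<^sub>R v) has_derivative (\<lambda>t. t *\<^sub>R v)) (at 0)"
    by (auto intro!: derivative_eq_intros)
  have "((\<lambda>t. g (x + t *\<^sub>R v)) has_derivative (\<lambda>t. blinfun_apply D (t *\<^sub>R v))) (at 0)"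
    by (rule has_derivative_compose[OF line]) (use g' in simp)
  then have "((\<lambda>t. g (x + t *\<^sub>R v)) has_real_derivative blinfun_apply D v) (at 0)"
    by (simp add: has_field_derivative_def blinfun.scaleR_right mult_commute_abs)
  then have lim: "((\<lambda>t. (g (x + t *\<^sub>R v) - g x) / t) \<longlongrightarrow> blinfun_apply D v) (at 0)"
    by (simp add: has_field_derivative_iff)
  have "((\<lambda>t. x + t *\<^sub>R v) \<longlongrightarrow> x + 0 *\<^sub>R v) (at 0)" by (intro tendsto_intros)
  then have "\<forall>\<^sub>F t in at 0. x + t *\<^sub>R v \<in> U"
    using assms(1,2) by (simp add: tendsto_def)
  then have "\<forall>\<^sub>F t in at 0. norm ((g (x + t *\<^sub>R v) - g x) / t) \<le> M * norm v"
  proof (rule eventually_mono[OF eventually_conj[OF _ eventually_neq_at_within[of 0]]])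
    fix t assume *: "x + t *\<^sub>R v \<in> U \<and> t \<noteq> 0"
    then have "\<bar>g (x + t *\<^sub>R v) - g x\<bar> \<le> M * (\<bar>t\<bar> * norm v)" using lip[of "x + t *\<^sub>R v"] by simp
    with * show "norm ((g (x + t *\<^sub>R v) - g x) / t) \<le> M * norm v" by (simp add: field_simps)
  qed
  then show "norm (blinfun_apply D v) \<le> M * norm v"
    by (rule Lim_norm_ubound[OF _ lim, rotated]) simp
qed

text \<open>The Lipschitz constants bound the derivatives, so the series of derivatives converges uniformly by
the Weierstrass test. This way the derivatives of the terms need never be computed.\<close>

lemma C1_on_suminf:
  fixes g :: "nat \<Rightarrow> 'a::real_normed_vector \<Rightarrow> real"
  assumes U: "open U" "convex U" and C1: "\<And>k. C1_on U (g k)"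
    and lip: "\<And>k x y. x \<in> U \<Longrightarrow> y \<in> U \<Longrightarrow> \<bar>g k x - g k y\<bar> \<le> M k * norm (x - y)"
    and M: "\<And>k. M k \<ge> 0" "summable M" and x0: "x0 \<in> U" "summable (\<lambda>k. g k x0)"
  shows "C1_on U (\<lambda>x. \<Sum>k. g k x)" and "x \<in> U \<Longrightarrow> summable (\<lambda>k. g k x)"
proof -
  have "\<forall>k. \<exists>g'. (\<forall>x\<in>U. (g k has_derivative blinfun_apply (g' x)) (at x)) \<and> continuous_on U g'"
    using C1 unfolding C1_on_def by blast
  from choice[OF this] obtain g' where
    g': "\<And>k x. x \<in> U \<Longrightarrow> (g k has_derivative blinfun_apply (g' k x)) (at x)" "\<And>k. continuous_on U (g' k)"
    by blast
  have bound: "norm (g' k x) \<le> M k" if "x \<in> U" for k x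
    using U(1) that g'(1)[OF that] lip[OF _ that] M(1) by (rule norm_derivative_le_lipschitz)
  define G' where "G' x = (\<Sum>k. g' k x)" for x
  have unif: "uniform_limit U (\<lambda>n x. \<Sum>k<n. g' k x) G' sequentially"
    unfolding G'_def using bound M(2) by (rule Weierstrass_m_test)
  have "\<exists>s. \<forall>x\<in>U. (\<lambda>k. g k x) sums s x \<and> (s has_derivative blinfun_apply (G' x)) (at x within U)"
  proof (rule has_derivative_series[OF U(2)])
    show "(g k has_derivative blinfun_apply (g' k x)) (at x within U)" if "x \<in> U" for k x
      using g'(1)[OF that] by (rule has_derivative_at_withinI)
    show "x0 \<in> U" by fact
    show "(\<lambda>k. g k x0) sums (\<Sum>k. g k x0)" using x0(2) by (rule summable_sums)
    fix e :: real assume "e > 0"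
    from uniform_limitD[OF unif this]
    show "\<forall>\<^sub>F n in sequentially. \<forall>x\<in>U. \<forall>v.
        norm ((\<Sum>i<n. blinfun_apply (g' i x) v) - blinfun_apply (G' x) v) \<le> e * norm v"
    proof (rule eventually_mono, intro ballI allI)
      fix n and x v :: 'a
      assume *: "\<forall>x\<in>U. dist (\<Sum>k<n. g' k x) (G' x) < e" "x \<in> U"
      then have "norm ((\<Sum>k<n. g' k x) - G' x) \<le> e" by (simp add: dist_norm less_imp_le)
      then have "norm ((\<Sum>k<n. g' k x) - G' x) * norm v \<le> e * norm v" by (rule mult_right_mono) simp
      then show "norm ((\<Sum>i<n. blinfun_apply (g' i x) v) - blinfun_apply (G' x) v) \<le> e * norm v"
        using norm_blinfun[of "(\<Sum>k<n. g' k x) - G' x" v] by (simp add: blinfun.diff_left blinfun.sum_left)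
    qed
  qed
  then obtain s where s: "\<And>x. x \<in> U \<Longrightarrow> (\<lambda>k. g k x) sums s x"
    "\<And>x. x \<in> U \<Longrightarrow> (s has_derivative blinfun_apply (G' x)) (at x within U)" by blast
  show "summable (\<lambda>k. g k x)" if "x \<in> U" using s(1)[OF that] by (rule sums_summable)
  have "((\<lambda>x. \<Sum>k. g k x) has_derivative blinfun_apply (G' x)) (at x)" if x: "x \<in> U" for x
  proof (rule has_derivative_transform_within_open[OF _ U(1) x])
    show "(s has_derivative blinfun_apply (G' x)) (at x)"
      using s(2)[OF x] by (simp add: at_within_open[OF x U(1)])
    show "s z = (\<Sum>k. g k z)" if "z \<in> U" for z using s(1)[OF that] by (rule sums_unique)
  qed
  moreover have "continuous_on U G'"
    by (rule uniform_limit_theorem[OF _ unif]) (auto intro!: always_eventually continuous_on_sum g'(2))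
  ultimately show "C1_on U (\<lambda>x. \<Sum>k. g k x)"
    unfolding C1_on_def by (intro exI[where x=G']) simp
qed

section \<open>Contraction of the flow near the equilibrium\<close>

text \<open>Near 0 the map \<open>f - A\<close> has Lipschitz constant \<open>\<epsilon>\<close>, so passing from \<open>A\<close> to \<open>f\<close> costs at most half of the
dissipation \<open>c\<close> if \<open>\<epsilon>\<close> is small compared with the bound \<open>K\<close> of the form \<open>B\<close>.\<close>

lemma dissipative_near_equilibrium:
  fixes f :: "'a::euclidean_space \<Rightarrow> 'a" and B :: "'a \<Rightarrow> 'a \<Rightarrow> real"
  assumes C1: "C1_on UNIV f" and A: "(f has_derivative A) (at 0)"
    and B: "bounded_bilinear B" and c: "c > 0" "\<And>v. B v (A v) \<le> - c * (v \<bullet> v)"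
  obtains \<gamma> r where "\<gamma> > 0" "r > 0"
    "\<And>x y. x \<in> ball 0 r \<Longrightarrow> y \<in> ball 0 r \<Longrightarrow> B (x - y) (f x - f y) \<le> - \<gamma> * B (x - y) (x - y)"
proof -
  interpret B: bounded_bilinear B by fact
  obtain K where K: "K > 0" "\<And>a b. norm (B a b) \<le> norm a * norm b * K" using B.pos_bounded by blast
  obtain f' where f': "\<And>x. (f has_derivative blinfun_apply (f' x)) (at x)" "continuous_on UNIV f'"
    using C1 unfolding C1_on_def by blast
  have A_eq: "A = blinfun_apply (f' 0)" using A f'(1) by (rule has_derivative_unique)
  \<comment> \<open>Also the rate of decay: the remaining dissipation \<open>c / 2 * (z \<bullet> z)\<close> is at least \<open>\<epsilon> * B z z\<close>.\<close>
  define \<epsilon> where "\<epsilon> = c / (2 * K)"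
  have \<epsilon>: "\<epsilon> > 0" "\<epsilon> * K = c / 2" using c K by (simp_all add: \<epsilon>_def)
  have "isCont f' 0" using f'(2) by (simp add: continuous_on_eq_continuous_at)
  then obtain r where r: "r > 0" "\<And>z. dist z 0 < r \<Longrightarrow> dist (f' z) (f' 0) < \<epsilon>"
    using \<epsilon>(1) unfolding continuous_at_eps_delta by blast
  have "B (x - y) (f x - f y) \<le> - \<epsilon> * B (x - y) (x - y)" if xy: "x \<in> ball 0 r" "y \<in> ball 0 r" for x y
  proof -
    define z where "z = x - y"
    define w where "w = (f x - blinfun_apply (f' 0) x) - (f y - blinfun_apply (f' 0) y)"
    have "norm w \<le> \<epsilon> * norm (x - y)"
      unfolding w_def
    proof (rule differentiable_bound[where S="ball 0 r" and f'="\<lambda>z. blinfun_apply (f' z - f' 0)"])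
      show "((\<lambda>z. f z - blinfun_apply (f' 0) z) has_derivative blinfun_apply (f' p - f' 0)) (at p within ball 0 r)"
        for p
        using has_derivative_diff[OF f'(1)[THEN has_derivative_at_withinI]
            bounded_linear_imp_has_derivative[OF blinfun.bounded_linear_right]]
        by (simp add: minus_blinfun.rep_eq)
      show "onorm (blinfun_apply (f' p - f' 0)) \<le> \<epsilon>" if "p \<in> ball 0 r" for p
        using r(2)[of p] that by (simp add: norm_blinfun.rep_eq[symmetric] dist_norm less_imp_le)
    qed (use xy in auto)
    then have "norm z * norm w * K \<le> norm z * (\<epsilon> * norm z) * K"
      using K(1) by (intro mult_right_mono mult_left_mono) (auto simp: z_def)
    also have "\<dots> = (\<epsilon> * K) * (z \<bullet> z)"
      by (simp add: dot_square_norm power2_eq_square)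
    also have "\<dots> = c / 2 * (z \<bullet> z)" by (simp only: \<epsilon>(2))
    finally have "B z w \<le> c / 2 * (z \<bullet> z)" using K(2)[of z w] by simp
    moreover have "f x - f y = A z + w"
      by (simp add: A_eq z_def w_def blinfun.diff_right)
    ultimately have "B z (f x - f y) \<le> - (c / 2) * (z \<bullet> z)"
      using c(2)[of z] by (simp add: B.add_right)
    also have "\<dots> \<le> - \<epsilon> * B z z"
    proof -
      have "B z z \<le> (z \<bullet> z) * K" using K(2)[of z z] by (simp add: dot_square_norm power2_eq_square)
      then have "\<epsilon> * B z z \<le> \<epsilon> * ((z \<bullet> z) * K)" using \<epsilon>(1) by (intro mult_left_mono) auto
      also have "\<dots> = (\<epsilon> * K) * (z \<bullet> z)" by simp
      finally show ?thesis by (simp add: \<epsilon>(2))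
    qed
    finally show ?thesis by (simp only: z_def)
  qed
  with \<epsilon>(1) r(1) that show thesis by blast
qed

lemma flow_contracts_near_equilibrium:
  fixes f :: "'a::euclidean_space \<Rightarrow> 'a" and B :: "'a \<Rightarrow> 'a \<Rightarrow> real"
  assumes C1: "C1_on UNIV f" and f0: "f 0 = 0" and B: "bounded_bilinear B" "\<And>u v. B u v = B v u"
    and diss: "\<gamma> > 0" "r > 0"
      "\<And>x y. x \<in> ball 0 r \<Longrightarrow> y \<in> ball 0 r \<Longrightarrow> B (x - y) (f x - f y) \<le> - \<gamma> * B (x - y) (x - y)"
    and flow: "h > 0" "R > 0" "\<And>x. x \<in> ball 0 R \<Longrightarrow> flow_exists f h x"
      "\<And>x t. x \<in> ball 0 R \<Longrightarrow> t \<in> {0..h} \<Longrightarrow> flow f t x \<in> cball 0 (R + 1)"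
  obtains s \<rho> where "0 < s" "s < R" "0 \<le> \<rho>" "\<rho> < 1" "flow f h 0 = 0"
    "\<And>x y. norm x < s \<Longrightarrow> norm y < s \<Longrightarrow>
      B (flow f h x - flow f h y) (flow f h x - flow f h y) \<le> \<rho> * B (x - y) (x - y)"
proof -
  obtain L where L: "L > 0"
    "\<And>x y. x \<in> cball 0 (R + 1) \<Longrightarrow> y \<in> cball 0 (R + 1) \<Longrightarrow> norm (f x - f y) \<le> L * norm (x - y)"
    using C1_on_lipschitz_cball[OF C1 subset_UNIV] by blast
  have rest: "solves_ivp f 0 h (\<lambda>_. 0)"
    using flow(1) f0 by (simp add: solves_ivp_iff)
  have flow0: "flow f h 0 = 0" using flow_eq[OF C1 rest] flow(1) by simp
  \<comment> \<open>Norms grow by at most \<open>exp (L * h)\<close> up to time \<open>h\<close>, so such orbits do not leave the dissipative ball.\<close>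
  define s where "s = min (R / 2) (r * exp (- L * h))"
  have s: "0 < s" "s < R" "s \<le> r * exp (- L * h)" using flow(2) diss(2) by (auto simp: s_def)
  have sol: "solves_ivp f x h (\<lambda>t. flow f t x)" if "norm x < s" for x
    using solves_ivp_flow[OF C1 flow(3)] that s flow(1) by simp
  have near: "flow f t x \<in> ball 0 r" if x: "norm x < s" and t: "t \<in> {0..h}" for x t
  proof -
    have xR: "x \<in> ball 0 R" using x s by simp
    have "(flow f t x - 0) \<bullet> (flow f t x - 0) \<le> exp (2 * L * t) * ((x - 0) \<bullet> (x - 0))"
    proof (rule quadratic_form_of_solutions[OF bounded_bilinear_inner inner_commute sol[OF x] rest])
      fix \<tau> assume "\<tau> \<in> {0..h}"
      from flow(4)[OF xR this] have "norm (f (flow f \<tau> x) - f 0) \<le> L * norm (flow f \<tau> x - 0)"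
        using flow(2) by (intro L(2)) auto
      then have "norm (flow f \<tau> x) * norm (f (flow f \<tau> x)) \<le> norm (flow f \<tau> x) * (L * norm (flow f \<tau> x))"
        by (intro mult_left_mono) (simp_all add: f0)
      then show "(flow f \<tau> x - 0) \<bullet> (f (flow f \<tau> x) - f 0) \<le> L * ((flow f \<tau> x - 0) \<bullet> (flow f \<tau> x - 0))"
        using norm_cauchy_schwarz[of "flow f \<tau> x" "f (flow f \<tau> x)"]
        by (simp add: f0 dot_square_norm power2_eq_square algebra_simps)
    qed (use t in auto)
    moreover have "exp (2 * L * t) = (exp (L * t))\<^sup>2" by (simp add: power2_eq_square flip: exp_add)
    ultimately have "(norm (flow f t x))\<^sup>2 \<le> (exp (L * t) * norm x)\<^sup>2"
      by (simp add: dot_square_norm power_mult_distrib)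
    then have "norm (flow f t x) \<le> exp (L * t) * norm x" by (rule power2_le_imp_le) simp
    also have "\<dots> \<le> exp (L * h) * norm x" using t L(1) by (intro mult_right_mono) auto
    also have "\<dots> < exp (L * h) * s" using x by simp
    also have "\<dots> \<le> exp (L * h) * (r * exp (- L * h))" using s(3) by (intro mult_left_mono) auto
    also have "\<dots> = r" by (simp add: exp_minus)
    finally show ?thesis by simp
  qed
  have contr: "B (flow f h x - flow f h y) (flow f h x - flow f h y) \<le> exp (2 * (- \<gamma>) * h) * B (x - y) (x - y)"
    if "norm x < s" "norm y < s" for x y
    by (rule quadratic_form_of_solutions[OF B sol[OF that(1)] sol[OF that(2)]])
       (use that near diss(3) flow(1) in auto)
  show thesis
    by (rule that[of s "exp (2 * (- \<gamma>) * h)"]) (use s flow0 contr diss(1) flow(1) in auto)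
qed

section \<open>Orbit sums of the time-h map\<close>

text \<open>The flow of the augmented field \<open>F (x, v) = (f x, w x)\<close> started at \<open>(x, 0)\<close> has second component
equal to the integral of \<open>w\<close> along the orbit of \<open>x\<close>.\<close>

lemma short_time_flow_and_integral:
  fixes f :: "'a::euclidean_space \<Rightarrow> 'a" and w :: "'a \<Rightarrow> real"
  assumes f: "C1_on UNIV f" and w: "C1_on UNIV w"
  obtains h where "h > 0" "\<And>x. x \<in> ball 0 R \<Longrightarrow> flow_exists f h x"
    "\<And>x t. x \<in> ball 0 R \<Longrightarrow> t \<in> {0..h} \<Longrightarrow> flow f t x \<in> cball 0 (R + 1)"
    "C1_on (ball 0 R) (flow f h)" "C1_on (ball 0 R) (\<lambda>x. integral {0..h} (\<lambda>s. w (flow f s x)))"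
proof -
  define F where "F p = (f (fst p), w (fst p))" for p :: "'a \<times> real"
  have "C1_on UNIV F"
    unfolding F_def[abs_def]
    by (intro C1_on_Pair C1_on_compose[OF C1_on_bounded_linear[OF bounded_linear_fst] f subset_UNIV]
        C1_on_compose[OF C1_on_bounded_linear[OF bounded_linear_fst] w subset_UNIV])
  from short_time_flow[OF this, of R] obtain h where h: "h > 0"
    "\<And>p. p \<in> ball 0 R \<Longrightarrow> flow_exists F h p"
    "\<And>p t. p \<in> ball 0 R \<Longrightarrow> t \<in> {0..h} \<Longrightarrow> flow F t p \<in> cball 0 (R + 1)"
    "C1_on (ball 0 R) (flow F h)" by blast
  have ball: "(x, 0 :: real) \<in> ball 0 R" if "x \<in> ball 0 R" for x :: 'a
    using that by (simp add: norm_Pair)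
  have sol: "solves_ivp F (x, 0) h (\<lambda>t. flow F t (x, 0))" if "x \<in> ball 0 R" for x
    using solves_ivp_flow[OF \<open>C1_on UNIV F\<close> h(2)[OF ball[OF that]]] h(1) by simp
  have solf: "solves_ivp f x h (\<lambda>t. fst (flow F t (x, 0)))" if "x \<in> ball 0 R" for x
    using sol[OF that] h(1) bounded_linear.has_vector_derivative[OF bounded_linear_fst]
    by (fastforce simp: solves_ivp_iff F_def)
  have flow_f: "flow f t x = fst (flow F t (x, 0))" if "x \<in> ball 0 R" "t \<in> {0..h}" for x t
    using flow_eq_on[OF f solf[OF that(1)]] that(2) by simp
  have int: "integral {0..h} (\<lambda>s. w (flow f s x)) = snd (flow F h (x, 0))" if x: "x \<in> ball 0 R" for x
  proof -
    have "((\<lambda>t. snd (flow F t (x, 0))) has_vector_derivative w (fst (flow F s (x, 0)))) (at s within {0..h})"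
      if "s \<in> {0..h}" for s
      using sol[OF x] h(1) that bounded_linear.has_vector_derivative[OF bounded_linear_snd]
      by (fastforce simp: solves_ivp_iff F_def)
    then have "((\<lambda>s. w (fst (flow F s (x, 0)))) has_integral
        (snd (flow F h (x, 0)) - snd (flow F 0 (x, 0)))) {0..h}"
      using h(1) by (intro fundamental_theorem_of_calculus) auto
    moreover have "snd (flow F 0 (x, 0)) = 0" using sol[OF x] by (simp add: solves_ivp_def)
    ultimately have "((\<lambda>s. w (flow f s x)) has_integral snd (flow F h (x, 0))) {0..h}"
      using flow_f[OF x] by (auto intro: has_integral_eq[rotated])
    then show ?thesis by (rule integral_unique)
  qed
  have emb: "C1_on (ball 0 R) (\<lambda>x::'a. flow F h (x, 0))"
    by (rule C1_on_compose[OF C1_on_bounded_linear h(4)])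
       (auto simp: dist_norm norm_Pair intro!: bounded_linear_Pair bounded_linear_zero bounded_linear_ident)
  show thesis
  proof (rule that[OF h(1)])
    show "flow_exists f h x" if "x \<in> ball 0 R" for x
      using solf[OF that] unfolding flow_exists_def by blast
    show "flow f t x \<in> cball 0 (R + 1)" if "x \<in> ball 0 R" "t \<in> {0..h}" for x t
      using h(3)[OF ball[OF that(1)] that(2)] flow_f[OF that] norm_fst_le[of "fst (flow F t (x, 0))" "snd (flow F t (x, 0))"]
      by simp
    have "C1_on (ball 0 R) (\<lambda>x::'a. fst (flow F h (x, 0)))"
      by (rule C1_on_compose[OF emb C1_on_bounded_linear[OF bounded_linear_fst] subset_UNIV])
    then show "C1_on (ball 0 R) (flow f h)"
      by (rule C1_on_cong[OF open_ball]) (use flow_f h(1) in simp)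
    have "C1_on (ball 0 R) (\<lambda>x::'a. snd (flow F h (x, 0)))"
      by (rule C1_on_compose[OF emb C1_on_bounded_linear[OF bounded_linear_snd] subset_UNIV])
    then show "C1_on (ball 0 R) (\<lambda>x. integral {0..h} (\<lambda>s. w (flow f s x)))"
      by (rule C1_on_cong[OF open_ball]) (rule int)
  qed
qed

text \<open>On a small sublevel set \<open>E\<close> of \<open>B\<close> the \<open>k\<close>-th term is Lipschitz with a constant proportional to \<open>sqrt \<rho> ^ k\<close>. Sublevel
sets of \<open>B\<close> are used rather than norm balls because they are mapped into themselves by \<open>\<psi>\<close>.\<close>

lemma C1_orbit_sum_near_fixed_point:
  fixes \<psi> :: "'a::euclidean_space \<Rightarrow> 'a" and G :: "'a \<Rightarrow> real" and B :: "'a \<Rightarrow> 'a \<Rightarrow> real"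
  assumes B: "bounded_bilinear B" "\<And>u v. B u v = B v u" "\<And>v. v \<bullet> v \<le> B v v"
    and s: "0 < s" "s < R" and \<rho>: "0 \<le> \<rho>" "\<rho> < 1"
    and contr: "\<And>x y. norm x < s \<Longrightarrow> norm y < s \<Longrightarrow> B (\<psi> x - \<psi> y) (\<psi> x - \<psi> y) \<le> \<rho> * B (x - y) (x - y)"
    and fixpoint: "\<psi> 0 = 0" "G 0 = 0" and C1: "C1_on (ball 0 R) \<psi>" "C1_on (ball 0 R) G"
  obtains E where "open E" "0 \<in> E" "E \<subseteq> ball 0 R" "\<psi> ` E \<subseteq> E"
    "C1_on E (\<lambda>x. \<Sum>k. G ((\<psi> ^^ k) x))" "\<And>x. x \<in> E \<Longrightarrow> summable (\<lambda>k. G ((\<psi> ^^ k) x))"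
proof -
  interpret B: bounded_bilinear B by fact
  obtain K where K: "K > 0" "\<And>a b. norm (B a b) \<le> norm a * norm b * K" using B.pos_bounded by blast
  have B_le: "B v v \<le> K * (norm v)\<^sup>2" for v
    using K(2)[of v v] by (simp add: power2_eq_square algebra_simps)
  have B_ge: "(norm v)\<^sup>2 \<le> B v v" for v
    using B(3)[of v] by (simp add: dot_square_norm)
  have B_nonneg: "0 \<le> B v v" for v using B_ge[of v] by (rule order_trans[OF zero_le_power2])
  define E where "E = {x. B x x < s\<^sup>2}"
  have E_small: "norm x < s" if "x \<in> E" for x
    using B_ge[of x] that s(1) by (auto simp: E_def intro: power2_less_imp_less)
  have "open E"
    unfolding E_def by (intro open_Collect_less B.continuous_on continuous_intros)
  have "0 \<in> E" using s(1) by (simp add: E_def B.zero_left)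
  have "convex E"
  proof (rule convexI)
    fix x y and u v :: real assume xy: "x \<in> E" "y \<in> E" and uv: "0 \<le> u" "0 \<le> v" "u + v = 1"
    have v: "v = 1 - u" using uv by simp
    \<comment> \<open>The parallelogram identity for \<open>B\<close>, weighted by \<open>u\<close> and \<open>v\<close>.\<close>
    have "B (u *\<^sub>R x + v *\<^sub>R y) (u *\<^sub>R x + v *\<^sub>R y) = u * B x x + v * B y y - u * v * B (x - y) (x - y)"
      unfolding v by (simp add: B.add_left B.add_right B.diff_left B.diff_right B.scaleR_left B.scaleR_right
          B(2)[of y x] algebra_simps)
    also have "\<dots> \<le> u * B x x + v * B y y" using uv B_nonneg by simp
    also have "\<dots> < s\<^sup>2" by (rule convex_bound_lt) (use xy uv in \<open>auto simp: E_def\<close>)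
    finally show "u *\<^sub>R x + v *\<^sub>R y \<in> E" by (simp add: E_def)
  qed
  have "E \<subseteq> ball 0 R" using E_small s(2) by force
  have \<psi>E: "\<psi> x \<in> E" if "x \<in> E" for x
  proof -
    have "B (\<psi> x) (\<psi> x) \<le> \<rho> * B x x" using contr[OF E_small[OF that], of 0] s(1) by (simp add: fixpoint)
    also have "\<dots> \<le> B x x" using \<rho> B_nonneg[of x] by (simp add: mult_left_le_one_le)
    finally show ?thesis using that by (simp add: E_def)
  qed
  have iterE: "(\<psi> ^^ k) x \<in> E" if "x \<in> E" for k x
    by (induction k) (simp_all add: that \<psi>E)
  have iter0: "(\<psi> ^^ k) 0 = 0" for k by (induction k) (simp_all add: fixpoint)
  have iter_contr: "B ((\<psi> ^^ k) x - (\<psi> ^^ k) y) ((\<psi> ^^ k) x - (\<psi> ^^ k) y) \<le> \<rho> ^ k * B (x - y) (x - y)"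
    if "x \<in> E" "y \<in> E" for k x y
  proof (induction k)
    case (Suc k)
    let ?d = "(\<psi> ^^ k) x - (\<psi> ^^ k) y"
    have "B ((\<psi> ^^ Suc k) x - (\<psi> ^^ Suc k) y) ((\<psi> ^^ Suc k) x - (\<psi> ^^ Suc k) y) \<le> \<rho> * B ?d ?d"
      using contr[OF E_small[OF iterE[OF that(1)]] E_small[OF iterE[OF that(2)]]] by simp
    also have "\<dots> \<le> \<rho> * (\<rho> ^ k * B (x - y) (x - y))" using Suc \<rho>(1) by (rule mult_left_mono)
    finally show ?case by (simp add: mult.assoc)
  qed simp
  have iter_C1: "C1_on E (\<psi> ^^ k)" for k
  proof (induction k)
    case 0
    show ?case using C1_on_bounded_linear[OF bounded_linear_ident] by (simp add: id_def)
  next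
    case (Suc k)
    have "C1_on E (\<lambda>x. \<psi> ((\<psi> ^^ k) x))"
      by (rule C1_on_compose[OF Suc C1(1)]) (use iterE \<open>E \<subseteq> ball 0 R\<close> in blast)
    then show ?case by (simp add: o_def)
  qed
  obtain L where L: "L > 0" "\<And>x y. x \<in> cball 0 s \<Longrightarrow> y \<in> cball 0 s \<Longrightarrow> norm (G x - G y) \<le> L * norm (x - y)"
    by (rule C1_on_lipschitz_cball[OF C1(2), of s]) (use s(2) in auto)
  define M where "M k = L * sqrt K * sqrt \<rho> ^ k" for k
  have lip: "\<bar>G ((\<psi> ^^ k) x) - G ((\<psi> ^^ k) y)\<bar> \<le> M k * norm (x - y)" if xy: "x \<in> E" "y \<in> E" for k x y
  proof -
    have "(norm ((\<psi> ^^ k) x - (\<psi> ^^ k) y))\<^sup>2 \<le> \<rho> ^ k * B (x - y) (x - y)"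
      by (rule order_trans[OF B_ge iter_contr[OF xy]])
    also have "\<dots> \<le> \<rho> ^ k * (K * (norm (x - y))\<^sup>2)" using \<rho>(1) by (intro mult_left_mono B_le) simp
    also have "\<dots> = (sqrt K * sqrt \<rho> ^ k * norm (x - y))\<^sup>2"
      using \<rho>(1) K(1) by (simp add: power_mult_distrib flip: real_sqrt_power)
    finally have "norm ((\<psi> ^^ k) x - (\<psi> ^^ k) y) \<le> sqrt K * sqrt \<rho> ^ k * norm (x - y)"
      by (rule power2_le_imp_le) (use \<rho> K in simp)
    then have "L * norm ((\<psi> ^^ k) x - (\<psi> ^^ k) y) \<le> L * (sqrt K * sqrt \<rho> ^ k * norm (x - y))"
      using L(1) by (intro mult_left_mono) auto
    moreover have "\<bar>G ((\<psi> ^^ k) x) - G ((\<psi> ^^ k) y)\<bar> \<le> L * norm ((\<psi> ^^ k) x - (\<psi> ^^ k) y)"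
      using L(2) E_small[OF iterE[OF xy(1), of k]] E_small[OF iterE[OF xy(2), of k]] by auto
    ultimately show ?thesis by (simp add: M_def mult.assoc)
  qed
  have GC1: "C1_on E (\<lambda>x. G ((\<psi> ^^ k) x))" for k
    by (rule C1_on_compose[OF iter_C1 C1(2)]) (use iterE \<open>E \<subseteq> ball 0 R\<close> in blast)
  have M: "M k \<ge> 0" "summable M" for k
    using L K \<rho> by (auto simp: M_def[abs_def] intro!: summable_mult summable_geometric)
  note series = C1_on_suminf[OF \<open>open E\<close> \<open>convex E\<close> GC1 lip M \<open>0 \<in> E\<close>]
  have "summable (\<lambda>k. G ((\<psi> ^^ k) 0))" by (simp add: iter0 fixpoint)
  with series \<psi>E show thesis
    by (intro that[OF \<open>open E\<close> \<open>0 \<in> E\<close> \<open>E \<subseteq> ball 0 R\<close>]) auto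
qed

text \<open>The points \<open>x\<close> with \<open>(\<psi> ^^ k) x \<in> D\<close> for \<open>k < N\<close> and \<open>(\<psi> ^^ N) x \<in> E\<close> form
an increasing sequence of open sets \<open>U N\<close>, because \<open>E\<close> is invariant. They cover \<open>K\<close>, so one of them
contains \<open>K\<close>. The identity \<open>S x = G x + S (\<psi> x)\<close> transfers smoothness of the sum from \<open>U N\<close> to \<open>U (Suc N)\<close>.\<close>

lemma C1_orbit_sum_near_compact:
  fixes \<psi> :: "'a::real_normed_vector \<Rightarrow> 'a" and G :: "'a \<Rightarrow> real"
  assumes E: "open E" "E \<subseteq> D" "\<psi> ` E \<subseteq> E" "C1_on E (\<lambda>x. \<Sum>k. G ((\<psi> ^^ k) x))"
      "\<And>x. x \<in> E \<Longrightarrow> summable (\<lambda>k. G ((\<psi> ^^ k) x))"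
    and D: "open D" "C1_on D \<psi>" "C1_on D G"
    and K: "compact K" "K \<subseteq> D" "\<psi> ` K \<subseteq> K" "\<And>x. x \<in> K \<Longrightarrow> \<exists>N. (\<psi> ^^ N) x \<in> E"
  obtains U where "open U" "K \<subseteq> U" "C1_on U (\<lambda>x. \<Sum>k. G ((\<psi> ^^ k) x))"
    "\<And>x. x \<in> U \<Longrightarrow> summable (\<lambda>k. G ((\<psi> ^^ k) x))"
proof -
  define S where "S x = (\<Sum>k. G ((\<psi> ^^ k) x))" for x
  define U where "U = rec_nat E (\<lambda>_ A. {x \<in> D. \<psi> x \<in> A})"
  have U_0: "U 0 = E" and U_Suc: "U (Suc N) = {x \<in> D. \<psi> x \<in> U N}" for N by (simp_all add: U_def)
  have mono: "U N \<subseteq> U (Suc N)" for N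
    by (induction N) (use E in \<open>auto simp: U_0 U_Suc\<close>)
  have U: "open (U N) \<and> C1_on (U N) S \<and> (\<forall>x\<in>U N. summable (\<lambda>k. G ((\<psi> ^^ k) x)))" for N
  proof (induction N)
    case 0
    show ?case using E unfolding U_0 S_def[abs_def] by blast
  next
    case (Suc N)
    have op: "open (U (Suc N))"
    proof -
      have "U (Suc N) = D \<inter> \<psi> -` U N" by (auto simp: U_Suc)
      then show ?thesis
        using continuous_open_preimage[OF C1_on_imp_continuous_on[OF D(2)] D(1)] Suc by simp
    qed
    have summ: "summable (\<lambda>k. G ((\<psi> ^^ k) x))" if "x \<in> U (Suc N)" for x
    proof -
      have "summable (\<lambda>k. G ((\<psi> ^^ k) (\<psi> x)))" using Suc that by (simp add: U_Suc)
      then have "summable (\<lambda>k. G ((\<psi> ^^ Suc k) x))" by (simp only: funpow_Suc_right o_apply)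
      then show ?thesis by (subst (asm) summable_Suc_iff)
    qed
    have "S x = G x + S (\<psi> x)" if "x \<in> U (Suc N)" for x
      using suminf_split_head[OF summ[OF that]] by (simp add: S_def funpow_swap1)
    moreover have "C1_on (U (Suc N)) (\<lambda>x. G x + S (\<psi> x))"
      using Suc D by (intro C1_on_add C1_on_compose[of _ \<psi> "U N" S]) (auto simp: U_Suc intro: C1_on_subset)
    ultimately have "C1_on (U (Suc N)) S" using C1_on_cong[OF op] by blast
    with op summ show ?case by blast
  qed
  have reach: "x \<in> K \<Longrightarrow> (\<psi> ^^ N) x \<in> E \<Longrightarrow> x \<in> U N" for N x
  proof (induction N arbitrary: x)
    case (Suc N)
    have "\<psi> x \<in> U N" using Suc K(3) by (intro Suc.IH) (auto simp: funpow_swap1)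
    then show ?case using Suc.prems(1) K(2) by (auto simp: U_Suc)
  qed (simp add: U_0)
  have "K \<subseteq> (\<Union>N. U N)" using K(4) reach by blast
  then obtain I where I: "finite I" "K \<subseteq> (\<Union>N\<in>I. U N)"
    using compactE_image[OF K(1), of UNIV U] U by auto
  have "U N \<subseteq> U (Max (insert 0 I))" if "N \<in> I" for N
    using lift_Suc_mono_le[of U, OF mono] I(1) that by simp
  with I(2) have "K \<subseteq> U (Max (insert 0 I))" by blast
  then show thesis using U[of "Max (insert 0 I)"] unfolding S_def[abs_def] by (intro that) auto
qed

section \<open>Improper integrals on the half line\<close>

text \<open>An unbounded domain is exhausted by boxes in the definition of the integral, and \<open>{0..}\<close> meets a box
containing 0 in some \<open>{0..b}\<close>.\<close>

lemma has_integral_of_tendsto_at_top: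
  fixes u :: "real \<Rightarrow> 'b::banach"
  assumes int: "\<And>T. T \<ge> 0 \<Longrightarrow> u integrable_on {0..T}"
    and lim: "((\<lambda>T. integral {0..T} u) \<longlongrightarrow> S) at_top"
  shows "(u has_integral S) {0..}"
proof -
  have Int: "{0..} \<inter> cbox a b = {max 0 a..b}" for a b :: real by auto
  have "u integrable_on {max 0 a..b}" for a b
  proof (cases "b \<ge> 0")
    case True
    show ?thesis by (rule integrable_on_subinterval[OF int[OF True]]) auto
  qed (simp add: integrable_on_empty)
  moreover have "\<exists>B>0. \<forall>a b. ball 0 B \<subseteq> cbox a b \<longrightarrow> norm (integral {max 0 a..b} u - S) < e" if e: "e > 0" for e
  proof -
    obtain T where T: "\<And>t. t \<ge> T \<Longrightarrow> dist (integral {0..t} u) S < e"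
      using tendstoD[OF lim e] unfolding eventually_at_top_linorder by blast
    have "norm (integral {max 0 a..b} u - S) < e" if sub: "ball 0 (max T 0 + 1) \<subseteq> cbox a b" for a b
    proof -
      have "max T 0 \<in> ball 0 (max T 0 + 1)" "- max T 0 \<in> ball 0 (max T 0 + 1)" by auto
      then have "max T 0 \<in> cbox a b" "- max T 0 \<in> cbox a b" using sub by blast+
      then have "max 0 a = 0" "b \<ge> T" by (auto simp: max_def split: if_splits)
      with T[of b] show ?thesis by (simp add: dist_norm)
    qed
    then show ?thesis by (intro exI[where x="max T 0 + 1"]) auto
  qed
  ultimately show ?thesis
    unfolding has_integral_alt' integral_restrict_Int integrable_restrict_Int Int by blast
qed

lemma tendsto_at_top_of_has_integral:
  fixes u :: "real \<Rightarrow> 'b::banach"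
  assumes "(u has_integral S) {0..}"
  shows "((\<lambda>T. integral {0..T} u) \<longlongrightarrow> S) at_top"
proof (rule tendstoI)
  fix e :: real assume "e > 0"
  have Int: "{0..} \<inter> cbox a b = {max 0 a..b}" for a b :: real by auto
  obtain C where C: "C > 0"
    "\<And>a b. ball 0 C \<subseteq> cbox a b \<Longrightarrow> norm (integral {max 0 a..b} u - S) < e"
    using assms \<open>e > 0\<close> unfolding has_integral_alt' integral_restrict_Int Int by blast
  have "dist (integral {0..T} u) S < e" if "T \<ge> C" for T
  proof -
    have "ball 0 C \<subseteq> cbox (- C) T" using that by (auto simp: dist_norm)
    from C(2)[OF this] C(1) show ?thesis by (simp add: dist_norm)
  qed
  then show "\<forall>\<^sub>F T in at_top. dist (integral {0..T} u) S < e"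
    unfolding eventually_at_top_linorder by blast
qed

text \<open>Between consecutive multiples of \<open>h\<close> the integral varies by at most \<open>h\<close> times a bound on \<open>u\<close>, which
tends to 0.\<close>

lemma tendsto_integral_of_discrete:
  fixes u :: "real \<Rightarrow> 'b::banach"
  assumes u: "continuous_on {0..} u" "(u \<longlongrightarrow> 0) at_top" and h: "h > 0"
    and lim: "(\<lambda>N. integral {0..real N * h} u) \<longlonglongrightarrow> S"
  shows "((\<lambda>T. integral {0..T} u) \<longlongrightarrow> S) at_top"
proof (rule tendstoI)
  fix e :: real assume e: "e > 0"
  obtain N0 where N0: "\<And>N. N \<ge> N0 \<Longrightarrow> dist (integral {0..real N * h} u) S < e / 2"
    using tendstoD[OF lim, of "e / 2"] e unfolding eventually_sequentially by auto
  obtain T0 where T0: "\<And>t. t \<ge> T0 \<Longrightarrow> dist (u t) 0 < e / (2 * h)"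
    using tendstoD[OF u(2), of "e / (2 * h)"] e h unfolding eventually_at_top_linorder by auto
  have "dist (integral {0..T} u) S < e" if T: "T \<ge> max 0 (max (T0 + h) ((real N0 + 1) * h))" for T
  proof -
    define N where "N = nat \<lfloor>T / h\<rfloor>"
    have "real N = of_int \<lfloor>T / h\<rfloor>" using T h by (simp add: N_def)
    then have "real N \<le> T / h" "T / h < real N + 1" by linarith+
    then have N: "real N * h \<le> T" "T < real N * h + h" using h by (simp_all add: field_simps)
    moreover have "real N0 * h + h \<le> T" using T by (simp add: algebra_simps)
    ultimately have "real N0 * h < real N * h" by linarith
    then have "N \<ge> N0" using h by simp
    have cont: "continuous_on {a..b} u" if "a \<ge> 0" for a b
      by (rule continuous_on_subset[OF u(1)]) (use that in auto)
    have "norm (integral {real N * h..T} u) \<le> e / (2 * h) * (T - real N * h)"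
    proof (rule integral_bound)
      show "continuous_on {real N * h..T} u" by (rule cont) (use h in simp)
      fix t assume "t \<in> {real N * h..T}"
      then have "t \<ge> T0" using T N(2) by auto
      from T0[OF this] show "norm (u t) \<le> e / (2 * h)" by simp
    qed (fact N(1))
    also have "\<dots> \<le> e / (2 * h) * h" using N(2) e h by (intro mult_left_mono) auto
    also have "\<dots> = e / 2" using h by simp
    finally have "norm (integral {real N * h..T} u) \<le> e / 2" .
    moreover have "integral {0..T} u = integral {0..real N * h} u + integral {real N * h..T} u"
      by (rule Henstock_Kurzweil_Integration.integral_combine[symmetric])
         (use N(1) h cont[of 0] in \<open>auto intro: integrable_continuous_real\<close>)
    ultimately show ?thesis
      using N0[OF \<open>N \<ge> N0\<close>] norm_triangle_ineq[of "integral {0..real N * h} u - S" "integral {real N * h..T} u"]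
      by (simp add: dist_norm algebra_simps)
  qed
  then show "\<forall>\<^sub>F T in at_top. dist (integral {0..T} u) S < e"
    unfolding eventually_at_top_linorder by blast
qed

lemma has_integral_tail:
  fixes u :: "real \<Rightarrow> 'b::banach"
  assumes u: "continuous_on {0..} u" "(u has_integral S) {0..}" and t: "t \<ge> 0"
  shows "((\<lambda>s. u (t + s)) has_integral (S - integral {0..t} u)) {0..}"
proof (rule has_integral_of_tendsto_at_top)
  have "continuous_on {0..} (\<lambda>s. u (t + s))"
    by (rule continuous_on_compose2[OF u(1)]) (use t in \<open>auto intro!: continuous_intros\<close>)
  then show "(\<lambda>s. u (t + s)) integrable_on {0..T}" for T
    by (intro integrable_continuous_real) (rule continuous_on_subset, auto)
  have "((\<lambda>T. integral {0..t + T} u) \<longlongrightarrow> S) at_top"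
    using filterlim_compose[OF tendsto_at_top_of_has_integral[OF u(2)] filterlim_tendsto_add_at_top[OF tendsto_const filterlim_ident]] .
  then have "((\<lambda>T. integral {0..t + T} u - integral {0..t} u) \<longlongrightarrow> S - integral {0..t} u) at_top"
    by (intro tendsto_diff tendsto_const)
  moreover have "integral {0..t + T} u - integral {0..t} u = integral {0..T} (\<lambda>s. u (t + s))" if "T \<ge> 0" for T
  proof -
    have "continuous_on {0..t + T} u" by (rule continuous_on_subset[OF u(1)]) auto
    then have "integral {0..t} u + integral {t..t + T} u = integral {0..t + T} u"
      using t that by (intro Henstock_Kurzweil_Integration.integral_combine integrable_continuous_real) auto
    moreover have "integral {0..T} (\<lambda>s. u (t + s)) = integral {t..t + T} u"
      using integral_shift_Icc_real[of 0 T u t] by (simp add: o_def add.commute)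
    ultimately show ?thesis by (simp add: algebra_simps)
  qed
  ultimately show "((\<lambda>T. integral {0..T} (\<lambda>s. u (t + s))) \<longlongrightarrow> S - integral {0..t} u) at_top"
    by (elim Lim_transform_eventually) (auto intro: eventually_mono[OF eventually_ge_at_top[of 0]])
qed

section \<open>Integrals along orbits\<close>

lemma gradient_inner:
  fixes W :: "'a::euclidean_space \<Rightarrow> real"
  assumes "(W has_derivative D) (at x)"
  shows "gradient W x \<bullet> v = D v"
proof -
  have "linear D" using assms by (simp add: has_derivative_bounded_linear bounded_linear.linear)
  then have "D = (\<lambda>v. v \<bullet> adjoint D 1)" by (simp add: fun_eq_iff adjoint_works)
  with assms have "GDERIV W x :> adjoint D 1" by (simp add: gderiv_def)
  moreover have "E = adjoint D 1" if "GDERIV W x :> E" for E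
  proof -
    have "(\<lambda>v. v \<bullet> E) = (\<lambda>v. v \<bullet> adjoint D 1)"
      using that \<open>GDERIV W x :> adjoint D 1\<close> unfolding gderiv_def by (rule has_derivative_unique)
    then show ?thesis by (metis vector_eq_ldot)
  qed
  ultimately have "gradient W x = adjoint D 1"
    unfolding gradient_def by (rule the_equality)
  then show ?thesis using \<open>linear D\<close> by (simp add: adjoint_works inner_commute)
qed

lemma C1_on_along_solution:
  fixes f :: "'a::euclidean_space \<Rightarrow> 'a" and W :: "'a \<Rightarrow> real"
  assumes "C1_on U W" and "solves_ivp f x T y" and t: "t \<in> {0..T}" and "y t \<in> U"
  shows "((\<lambda>s. W (y s)) has_real_derivative gradient W (y t) \<bullet> f (y t)) (at t within {0..T})"
proof -
  obtain D where D: "(W has_derivative D) (at (y t))"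
    using assms(1,4) unfolding C1_on_def by blast
  have "(y has_derivative (\<lambda>r. r *\<^sub>R f (y t))) (at t within {0..T})"
    using assms(2) t by (simp add: solves_ivp_iff has_vector_derivative_def)
  from has_derivative_compose[OF this D]
  have "((\<lambda>s. W (y s)) has_derivative (\<lambda>r. D (r *\<^sub>R f (y t)))) (at t within {0..T})" .
  moreover have "D (r *\<^sub>R f (y t)) = (gradient W (y t) \<bullet> f (y t)) * r" for r
    using gradient_inner[OF D, of "r *\<^sub>R f (y t)"] by (simp add: mult.commute)
  ultimately show ?thesis by (simp add: has_field_derivative_def)
qed

context
  fixes f :: "'a::euclidean_space \<Rightarrow> 'a" and x :: 'a
  assumes C1: "C1_on UNIV f" and global: "\<forall>t\<ge>0. flow_exists f t x"
begin

lemma continuous_on_flow: "continuous_on {0..} (\<lambda>t. flow f t x)"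
proof -
  have "continuous (at t within {0..}) (\<lambda>t. flow f t x)" if "t \<ge> 0" for t
  proof -
    have "continuous_on {0..t + 1} (\<lambda>t. flow f t x)"
      by (rule solves_ivp_continuous_on[OF _ solves_ivp_flow[OF C1 global[rule_format]]]) (use that in auto)
    then have "continuous (at t within {0..t + 1}) (\<lambda>t. flow f t x)"
      using that by (simp add: continuous_on_eq_continuous_within)
    moreover have "at t within {0..} = at t within {0..t + 1}"
      using that by (intro at_within_nhd[where S="{..<t + 1}"]) auto
    ultimately show ?thesis by simp
  qed
  then show ?thesis by (simp add: continuous_on_eq_continuous_within)
qed

lemma continuous_on_along_flow:
  "C1_on UNIV w \<Longrightarrow> continuous_on {0..} (\<lambda>t. w (flow f t x))"
  using continuous_on_compose2[OF C1_on_imp_continuous_on continuous_on_flow] by blast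

lemma flow_iterate:
  assumes "h \<ge> 0" shows "flow f (real N * h) x = (flow f h ^^ N) x"
proof (induction N)
  case 0
  show ?case using flow_zero[OF C1 global[rule_format], of 0] by simp
next
  case (Suc N)
  have "flow f (real N * h + h) x = flow f h (flow f (real N * h) x)"
    using assms by (intro flow_add[OF C1 global[rule_format]]) auto
  with Suc show ?case by (simp add: algebra_simps)
qed

text \<open>Cutting \<open>{0..N * h}\<close> into pieces of length \<open>h\<close> and applying the semigroup law on each of them.\<close>

lemma integral_flow_iterates:
  fixes w :: "'a \<Rightarrow> real"
  assumes "h > 0" and w: "C1_on UNIV w"
  shows "integral {0..real N * h} (\<lambda>s. w (flow f s x)) =
    (\<Sum>k<N. integral {0..h} (\<lambda>s. w (flow f s ((flow f h ^^ k) x))))"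
proof (induction N)
  case (Suc N)
  let ?u = "\<lambda>s. w (flow f s x)"
  have "continuous_on {0..real N * h + h} ?u"
    by (rule continuous_on_subset[OF continuous_on_along_flow[OF w]]) auto
  then have "integral {0..real N * h} ?u + integral {real N * h..real N * h + h} ?u = integral {0..real N * h + h} ?u"
    using \<open>h > 0\<close> by (intro Henstock_Kurzweil_Integration.integral_combine integrable_continuous_real) auto
  moreover have "integral {real N * h..real N * h + h} ?u = integral {0..h} (\<lambda>s. ?u (real N * h + s))"
    using integral_shift_Icc_real[of 0 h ?u "real N * h"] by (simp add: o_def add.commute)
  moreover have "\<dots> = integral {0..h} (\<lambda>s. w (flow f s ((flow f h ^^ N) x)))"
  proof (rule Henstock_Kurzweil_Integration.integral_cong)
    fix s assume "s \<in> {0..h}"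
    then have "flow f (real N * h + s) x = flow f s (flow f (real N * h) x)"
      using \<open>h > 0\<close> by (intro flow_add[OF C1 global[rule_format]]) auto
    then show "?u (real N * h + s) = w (flow f s ((flow f h ^^ N) x))"
      using flow_iterate \<open>h > 0\<close> by simp
  qed
  ultimately show ?case using Suc by (simp add: algebra_simps)
qed simp

lemma has_integral_orbit_sum:
  fixes w :: "'a \<Rightarrow> real"
  assumes "h > 0" and w: "C1_on UNIV w" "w 0 = 0"
    and lim: "((\<lambda>t. flow f t x) \<longlongrightarrow> 0) at_top"
    and summ: "summable (\<lambda>k. integral {0..h} (\<lambda>s. w (flow f s ((flow f h ^^ k) x))))"
  shows "((\<lambda>t. w (flow f t x)) has_integral
    (\<Sum>k. integral {0..h} (\<lambda>s. w (flow f s ((flow f h ^^ k) x))))) {0..}"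
proof (rule has_integral_of_tendsto_at_top)
  show "(\<lambda>t. w (flow f t x)) integrable_on {0..T}" for T
    by (intro integrable_continuous_real continuous_on_subset[OF continuous_on_along_flow[OF w(1)]]) auto
  have "isCont w 0"
    using C1_on_imp_continuous_on[OF w(1)] by (simp add: continuous_on_eq_continuous_at)
  from isCont_tendsto_compose[OF this lim] have "((\<lambda>t. w (flow f t x)) \<longlongrightarrow> 0) at_top"
    by (simp add: w(2))
  then show "((\<lambda>T. integral {0..T} (\<lambda>t. w (flow f t x))) \<longlongrightarrow>
      (\<Sum>k. integral {0..h} (\<lambda>s. w (flow f s ((flow f h ^^ k) x))))) at_top"
  proof (rule tendsto_integral_of_discrete[OF continuous_on_along_flow[OF w(1)] _ \<open>h > 0\<close>])
    show "(\<lambda>N. integral {0..real N * h} (\<lambda>t. w (flow f t x))) \<longlonglongrightarrow>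
      (\<Sum>k. integral {0..h} (\<lambda>s. w (flow f s ((flow f h ^^ k) x))))"
      using summable_LIMSEQ[OF summ] by (simp add: integral_flow_iterates[OF \<open>h > 0\<close> w(1)])
  qed
qed

end

lemma flow_of_equilibrium:
  fixes f :: "'a::euclidean_space \<Rightarrow> 'a"
  assumes "C1_on UNIV f" "f 0 = 0" "t \<ge> 0" shows "flow f t 0 = 0"
proof -
  have "solves_ivp f 0 t (\<lambda>_. 0)" using assms by (simp add: solves_ivp_iff)
  from flow_eq[OF assms(1) this assms(3)] show ?thesis .
qed

section \<open>The value function and the Lyapunov equation\<close>

text \<open>The extension is the orbit sum of the time-\<open>h\<close> map; outside \<open>K\<close> it is not claimed to be an integral.\<close>

lemma C1_extension_of_orbit_integral:
  fixes f :: "real^'n \<Rightarrow> real^'n" and w :: "real^'n \<Rightarrow> real" and K :: "(real^'n) set"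
  assumes f: "f \<in> F_st" and w: "C1_on UNIV w" "w 0 = 0"
    and K: "K \<subseteq> DOA f" "compact K" "positively_invariant f K"
  obtains U W where "open U" "K \<subseteq> U" "C1_on U W"
    "\<And>x. x \<in> K \<Longrightarrow> ((\<lambda>t. w (flow f t x)) has_integral W x) {0..}"
proof -
  have C1: "C1_on UNIV f" and f0: "f 0 = 0" and hur: "hurwitz (jacobian f (at 0))"
    using f by (auto simp: F_st_def)
  have "f differentiable at 0" using C1 unfolding C1_on_def differentiable_def by blast
  then have A: "(f has_derivative (\<lambda>v. jacobian f (at 0) *v v)) (at 0)" by (simp add: jacobian_works)
  obtain B :: "real^'n \<Rightarrow> real^'n \<Rightarrow> real" and c where
    B: "bounded_bilinear B" "\<And>u v. B u v = B v u" "\<And>v. v \<bullet> v \<le> B v v"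
    and c: "c > 0" "\<And>v. B v (jacobian f (at 0) *v v) \<le> - c * (v \<bullet> v)"
    using hurwitz_lyapunov_form[OF hur] by metis
  obtain \<gamma> r where \<gamma>: "\<gamma> > 0" "r > 0"
    "\<And>x y. x \<in> ball 0 r \<Longrightarrow> y \<in> ball 0 r \<Longrightarrow> B (x - y) (f x - f y) \<le> - \<gamma> * B (x - y) (x - y)"
    using dissipative_near_equilibrium[OF C1 A B(1) c] by blast
  obtain b where "b > 0" "\<forall>x\<in>K. norm x \<le> b"
    using compact_imp_bounded[OF K(2)] bounded_pos by metis
  then have R: "b + 1 > 0" "K \<subseteq> ball 0 (b + 1)" by force+
  obtain h where h: "h > 0" "\<And>x. x \<in> ball 0 (b + 1) \<Longrightarrow> flow_exists f h x"
    "\<And>x t. x \<in> ball 0 (b + 1) \<Longrightarrow> t \<in> {0..h} \<Longrightarrow> flow f t x \<in> cball 0 (b + 1 + 1)"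
    "C1_on (ball 0 (b + 1)) (flow f h)" "C1_on (ball 0 (b + 1)) (\<lambda>x. integral {0..h} (\<lambda>s. w (flow f s x)))"
    using short_time_flow_and_integral[OF C1 w(1), of "b + 1"] by blast
  obtain s \<rho> where s: "0 < s" "s < b + 1" and \<rho>: "0 \<le> \<rho>" "\<rho> < 1" and fix0: "flow f h 0 = 0"
    and contr: "\<And>x y. norm x < s \<Longrightarrow> norm y < s \<Longrightarrow>
      B (flow f h x - flow f h y) (flow f h x - flow f h y) \<le> \<rho> * B (x - y) (x - y)"
    using flow_contracts_near_equilibrium[OF C1 f0 B(1,2) \<gamma> h(1) R(1) h(2,3)] by blast
  define G where "G x = integral {0..h} (\<lambda>s. w (flow f s x))" for x
  have G0: "G 0 = 0"
    unfolding G_def using flow_of_equilibrium[OF C1 f0] w(2)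
    by (intro integral_unique has_integral_is_0) auto
  have GC1: "C1_on (ball 0 (b + 1)) G" unfolding G_def[abs_def] by (rule h(5))
  obtain E where E: "open E" "0 \<in> E" "E \<subseteq> ball 0 (b + 1)" "flow f h ` E \<subseteq> E"
    "C1_on E (\<lambda>x. \<Sum>k. G ((flow f h ^^ k) x))" "\<And>x. x \<in> E \<Longrightarrow> summable (\<lambda>k. G ((flow f h ^^ k) x))"
    using C1_orbit_sum_near_fixed_point[OF B s \<rho> contr fix0 G0 h(4) GC1] by blast
  have orbit: "\<forall>t\<ge>0. flow_exists f t x" "\<forall>t\<ge>0. flow f t x \<in> K" if "x \<in> K" for x
    using K(3) that unfolding positively_invariant_def by blast+
  have lim: "((\<lambda>t. flow f t x) \<longlongrightarrow> 0) at_top" if "x \<in> K" for x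
    using K(1) that by (auto simp: DOA_def)
  have reach: "\<exists>N. (flow f h ^^ N) x \<in> E" if x: "x \<in> K" for x
  proof -
    have "filterlim (\<lambda>N. real N * h) at_top sequentially"
      using h(1) by (intro filterlim_at_top_mult_tendsto_pos[OF tendsto_const _ filterlim_real_sequentially])
    from filterlim_compose[OF lim[OF x] this] have "(\<lambda>N. (flow f h ^^ N) x) \<longlonglongrightarrow> 0"
      using flow_iterate[OF C1 orbit(1)[OF x], of h] h(1) by simp
    from topological_tendstoD[OF this E(1,2)] show ?thesis
      unfolding eventually_sequentially by blast
  qed
  have "flow f h ` K \<subseteq> K" using orbit(2) h(1) by auto
  from C1_orbit_sum_near_compact[OF E(1,3,4,5,6) open_ball h(4) GC1 K(2) R(2) this reach]
  obtain U where U: "open U" "K \<subseteq> U" "C1_on U (\<lambda>x. \<Sum>k. G ((flow f h ^^ k) x))"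
    "\<And>x. x \<in> U \<Longrightarrow> summable (\<lambda>k. G ((flow f h ^^ k) x))" by blast
  show thesis
  proof (rule that[OF U(1-3)])
    fix x assume x: "x \<in> K"
    have summ: "summable (\<lambda>k. G ((flow f h ^^ k) x))" using U(2,4) x by blast
    show "((\<lambda>t. w (flow f t x)) has_integral (\<Sum>k. G ((flow f h ^^ k) x))) {0..}"
      unfolding G_def by (rule has_integral_orbit_sum[OF C1 orbit(1)[OF x] h(1) w lim[OF x] summ[unfolded G_def]])
  qed
qed

lemma orbit_integral_of_lyapunov_solution:
  fixes f :: "'a::euclidean_space \<Rightarrow> 'a"
  assumes f: "C1_on UNIV f" and w: "C1_on UNIV w"
    and K: "0 \<in> K" "positively_invariant f K" and V: "lyapunov_solution f w K V"
    and x: "x \<in> K" and lim: "((\<lambda>t. flow f t x) \<longlongrightarrow> 0) at_top"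
  shows "((\<lambda>t. w (flow f t x)) has_integral V x) {0..}"
proof -
  obtain U W where U: "open U" "K \<subseteq> U" "C1_on U W" and WV: "\<And>x. x \<in> K \<Longrightarrow> W x = V x"
    and pde: "\<And>x. x \<in> K \<Longrightarrow> gradient W x \<bullet> f x = - w x" and V0: "V 0 = 0"
    using V unfolding lyapunov_solution_def C1_extension_def by blast
  have orbit: "\<forall>t\<ge>0. flow_exists f t x" "\<forall>t\<ge>0. flow f t x \<in> K"
    using K(2) x unfolding positively_invariant_def by blast+
  have int: "((\<lambda>t. w (flow f t x)) has_integral V x - W (flow f T x)) {0..T}" if T: "T \<ge> 0" for T
  proof -
    have sol: "solves_ivp f x T (\<lambda>t. flow f t x)"
      using solves_ivp_flow[OF f] orbit(1) T by simp
    have "((\<lambda>t. - W (flow f t x)) has_vector_derivative w (flow f t x)) (at t within {0..T})"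
      if t: "t \<in> {0..T}" for t
    proof -
      have "flow f t x \<in> K" using orbit(2) t by simp
      with C1_on_along_solution[OF U(3) sol t] U(2) pde
      have "((\<lambda>s. W (flow f s x)) has_real_derivative - w (flow f t x)) (at t within {0..T})"
        by fastforce
      from DERIV_minus[OF this] show ?thesis
        by (simp add: has_real_derivative_iff_has_vector_derivative)
    qed
    from fundamental_theorem_of_calculus[OF T this]
    have "((\<lambda>t. w (flow f t x)) has_integral - W (flow f T x) - - W (flow f 0 x)) {0..T}" by simp
    then show ?thesis using flow_zero[OF f, of 0 x] orbit(1) WV[OF x] by simp
  qed
  have "isCont W 0"
    using C1_on_imp_continuous_on[OF U(3)] U(1,2) K(1) by (auto simp: continuous_on_eq_continuous_at)
  from isCont_tendsto_compose[OF this lim] have "((\<lambda>T. W (flow f T x)) \<longlongrightarrow> 0) at_top"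
    using WV[OF K(1)] V0 by simp
  from tendsto_diff[OF tendsto_const this, of "V x"]
  have "((\<lambda>T. V x - W (flow f T x)) \<longlongrightarrow> V x) at_top" by simp
  then have "((\<lambda>T. integral {0..T} (\<lambda>t. w (flow f t x))) \<longlongrightarrow> V x) at_top"
    by (elim Lim_transform_eventually)
       (auto simp: integral_unique[OF int] intro: eventually_mono[OF eventually_ge_at_top[of 0]])
  then show ?thesis
    by (rule has_integral_of_tendsto_at_top[rotated]) (use int in blast)
qed

text \<open>By the semigroup law \<open>W (flow f t x) = W x - integral {0..t} (\<lambda>s. w (flow f s x))\<close>. The two sides have
one-sided derivatives \<open>gradient W x \<bullet> f x\<close> and \<open>- w x\<close> at \<open>t = 0\<close>.\<close>

lemma gradient_of_orbit_integral:
  fixes f :: "'a::euclidean_space \<Rightarrow> 'a"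
  assumes f: "C1_on UNIV f" and w: "C1_on UNIV w" and K: "positively_invariant f K"
    and U: "K \<subseteq> U" "C1_on U W"
    and W: "\<And>x. x \<in> K \<Longrightarrow> ((\<lambda>t. w (flow f t x)) has_integral W x) {0..}" and x: "x \<in> K"
  shows "gradient W x \<bullet> f x = - w x"
proof -
  have orbit: "\<forall>t\<ge>0. flow_exists f t x" "\<forall>t\<ge>0. flow f t x \<in> K"
    using K x unfolding positively_invariant_def by blast+
  have sol: "solves_ivp f x 1 (\<lambda>t. flow f t x)"
    using solves_ivp_flow[OF f] orbit(1) by simp
  have flow0: "flow f 0 x = x" using sol by (simp add: solves_ivp_def)
  note cont = continuous_on_along_flow[OF f orbit(1) w]
  have "W (flow f t x) = W x - integral {0..t} (\<lambda>s. w (flow f s x))" if t: "t \<in> {0..1}" for t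
  proof -
    have "((\<lambda>s. w (flow f (t + s) x)) has_integral W x - integral {0..t} (\<lambda>s. w (flow f s x))) {0..}"
      by (rule has_integral_tail[OF cont W[OF x]]) (use t in simp)
    moreover have "w (flow f (t + s) x) = w (flow f s (flow f t x))" if "s \<in> {0..}" for s
      using flow_add[OF f, of t s x] orbit(1) t that by simp
    ultimately have "((\<lambda>s. w (flow f s (flow f t x))) has_integral W x - integral {0..t} (\<lambda>s. w (flow f s x))) {0..}"
      by (rule has_integral_eq[rotated])
    moreover have "((\<lambda>s. w (flow f s (flow f t x))) has_integral W (flow f t x)) {0..}"
      using W orbit(2) t by simp
    ultimately show ?thesis by (rule has_integral_unique[rotated])
  qed
  moreover have "((\<lambda>t. W x - integral {0..t} (\<lambda>s. w (flow f s x))) has_vector_derivative 0 - w (flow f 0 x)) (at 0 within {0..1})"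
    by (intro has_vector_derivative_diff has_vector_derivative_const integral_has_vector_derivative
        continuous_on_subset[OF cont]) auto
  ultimately have "((\<lambda>t. W (flow f t x)) has_vector_derivative - w x) (at 0 within cbox 0 1)"
    using has_vector_derivative_transform[of 0 "{0..1::real}" "\<lambda>t. W (flow f t x)"] flow0 by simp
  moreover have "((\<lambda>t. W (flow f t x)) has_vector_derivative gradient W x \<bullet> f x) (at 0 within cbox 0 1)"
    using C1_on_along_solution[OF U(2) sol, of 0] flow0 U(1) x
    by (auto simp: has_real_derivative_iff_has_vector_derivative)
  ultimately show ?thesis
    by (intro vector_derivative_unique_within_closed_interval[of 0 1 0]) auto
qed

theorem proposition1:
  fixes f :: "real^'n \<Rightarrow> real^'n" and \<omega> :: "real^'n \<Rightarrow> real" and K :: "(real^'n) set"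
  assumes "f \<in> F_st" and "\<omega> \<in> W_pos"
    and "K \<subseteq> DOA f" and "K \<noteq> {}" and "compact K" and "positively_invariant f K"
  shows "(\<forall>V. lyapunov_solution f \<omega> K V \<longleftrightarrow>
              (\<forall>x\<in>K. ((\<lambda>t. \<omega> (flow f t x)) has_integral V x) {0..})) \<and>
         (\<exists>!V. V \<in> extensional K \<and> lyapunov_solution f \<omega> K V) \<and>
         lyapunov_solution f \<omega> K (\<lambda>x\<in>K. integral {0..} (\<lambda>t. \<omega> (flow f t x)))"
proof -
  have f: "C1_on UNIV f" "f 0 = 0" and \<omega>: "C1_on UNIV \<omega>" "\<omega> 0 = 0"
    using assms(1,2) by (auto simp: F_st_def W_pos_def C2_on_def)
  have lim: "((\<lambda>t. flow f t x) \<longlongrightarrow> 0) at_top" if "x \<in> K" for x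
    using assms(3) that by (auto simp: DOA_def)
  have "0 \<in> K"
  proof -
    obtain x where x: "x \<in> K" using assms(4) by blast
    have "\<forall>\<^sub>F t in at_top. flow f t x \<in> K"
      using assms(6) x unfolding positively_invariant_def
      by (intro eventually_mono[OF eventually_ge_at_top[of 0]]) simp
    then show ?thesis
      by (rule Lim_in_closed_set[OF compact_imp_closed[OF assms(5)] _ trivial_limit_at_top_linorder lim[OF x]])
  qed
  obtain U W where U: "open U" "K \<subseteq> U" "C1_on U W"
    and W: "\<And>x. x \<in> K \<Longrightarrow> ((\<lambda>t. \<omega> (flow f t x)) has_integral W x) {0..}"
    using C1_extension_of_orbit_integral[OF assms(1) \<omega> assms(3,5,6)] by blast
  have grad: "gradient W x \<bullet> f x = - \<omega> x" if "x \<in> K" for x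
    using gradient_of_orbit_integral[OF f(1) \<omega>(1) assms(6) U(2,3) W that] .
  have "((\<lambda>t. \<omega> (flow f t 0)) has_integral 0) {0..}"
    using flow_of_equilibrium[OF f] \<omega>(2) by (intro has_integral_is_0) auto
  with W[OF \<open>0 \<in> K\<close>] have W0: "W 0 = 0" by (rule has_integral_unique)
  have sol_iff: "lyapunov_solution f \<omega> K V \<longleftrightarrow> (\<forall>x\<in>K. ((\<lambda>t. \<omega> (flow f t x)) has_integral V x) {0..})" for V
  proof
    assume "lyapunov_solution f \<omega> K V"
    then show "\<forall>x\<in>K. ((\<lambda>t. \<omega> (flow f t x)) has_integral V x) {0..}"
      using orbit_integral_of_lyapunov_solution[OF f(1) \<omega>(1) \<open>0 \<in> K\<close> assms(6)] lim by blast
  next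
    assume "\<forall>x\<in>K. ((\<lambda>t. \<omega> (flow f t x)) has_integral V x) {0..}"
    then have "\<forall>x\<in>K. W x = V x" using W has_integral_unique by blast
    with U grad W0 \<open>0 \<in> K\<close> show "lyapunov_solution f \<omega> K V"
      unfolding lyapunov_solution_def C1_extension_def by (metis (no_types, lifting))
  qed
  have integral_formula: "lyapunov_solution f \<omega> K (\<lambda>x\<in>K. integral {0..} (\<lambda>t. \<omega> (flow f t x)))"
    unfolding sol_iff using W by (auto simp: has_integral_iff)
  moreover have "V = V'" if "V \<in> extensional K \<and> lyapunov_solution f \<omega> K V"
    "V' \<in> extensional K \<and> lyapunov_solution f \<omega> K V'" for V V'
  proof (rule extensionalityI[of V K V'])
    show "V x = V' x" if "x \<in> K" for x
      using \<open>V \<in> _ \<and> _\<close> \<open>V' \<in> _ \<and> _\<close> that unfolding sol_iff by (meson has_integral_unique)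
  qed (use that in auto)
  ultimately have "\<exists>!V. V \<in> extensional K \<and> lyapunov_solution f \<omega> K V"
    by (intro ex1I[where a="\<lambda>x\<in>K. integral {0..} (\<lambda>t. \<omega> (flow f t x))"]) auto
  with sol_iff integral_formula show ?thesis by blast
qed

end
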